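(* A generic diffeomorphism $f$ in $\overline{\mathcal{O}}^{\infty}(\mathbb{T}^2)$ (and likewise a generic diffeomorphism in $\overline{\mathcal{O}_\mu}^{\infty}(\mathbb{T}^2)$) has the following property: for every point-symmetric compact convex set $K\subseteq\mathbb{R}^2$ containing more than one point, $f$ admits a generalized rotation set whose homothety type equals the homothety type of $K$.
   Context: $\mathbb{T}^2=\mathbb{R}^2/\mathbb{Z}^2$, $R_\theta(x)=x+\theta$. The Anosov–Katok class $\overline{\mathcal{O}}^{\infty}(\mathbb{T}^2)$ is the $C^\infty$-closure of $\{h\circ R_\theta\circ h^{-1}: h\in\mathrm{Diff}^\infty(\mathbb{T}^2),\theta\in\mathbb{T}^2\}$, a complete metric space with the $C^\infty$ metric; $\overline{\mathcal{O}_\mu}^{\infty}(\mathbb{T}^2)$ is the same with $h$ area-preserving. Generic means holding on a countable intersection of open dense sets. Let $D=[0,1]^2$ and fix $\tilde x_0\in D$. For a torus homeomorphism $f$ homotopic to the identity with lift $\tilde f:\mathbb{R}^2\to\mathbb{R}^2$: if for some sequence $(n_i)$ of natural numbers the limit $\lim_{i\to\infty}\frac{\tilde f^{n_i}(D)-\tilde f^{n_i}(\tilde x_0)}{\mathrm{diam}(\tilde f^{n_i}(D))}$ exists in the Hausdorff topology and $\mathrm{diam}(\tilde f^{n_i}(D))\to+\infty$, this limit is called a generalized rotation set of $f$ (such sets have diameter $1$). The homothety type $[K]$ of a non-empty compact $K\subseteq\mathbb{R}^2$ is its class modulo the group generated by translations and homotheties of positive ratio. *)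

theory Defs
  imports "HOL-Analysis.Analysis" "HOL-Library.Extended_Real"
begin

type_synonym R2 = "real^2"

text \<open>Integer vectors (the deck group of the covering R^2 to T^2).\<close>
definition intvecs :: "R2 set" where
  "intvecs = {k. \<forall>i. k $ i \<in> \<int>}"

fun pd :: "R2 list \<Rightarrow> (R2 \<Rightarrow> R2) \<Rightarrow> R2 \<Rightarrow> R2" where
  "pd [] F = F"
| "pd (v # vs) F = (\<lambda>x. frechet_derivative (pd vs F) (at x) v)"

definition smooth :: "(R2 \<Rightarrow> R2) \<Rightarrow> bool" where
  "smooth F \<longleftrightarrow> (\<forall>vs. set vs \<subseteq> Basis \<longrightarrow> (\<forall>x. pd vs F differentiable at x))"

text \<open>Lift of a C-infinity diffeomorphism of T^2 (arbitrary homotopy class).\<close>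
definition torus_diff_lift :: "(R2 \<Rightarrow> R2) \<Rightarrow> bool" where
  "torus_diff_lift H \<longleftrightarrow> bij H \<and> smooth H \<and> smooth (inv H) \<and>
     (\<forall>x k. k \<in> intvecs \<longrightarrow> H (x + k) - H x \<in> intvecs) \<and>
     (\<forall>x k. k \<in> intvecs \<longrightarrow> inv H (x + k) - inv H x \<in> intvecs)"

text \<open>Lift of a C-infinity diffeomorphism of T^2 homotopic to the identity.\<close>
definition lift_diff :: "(R2 \<Rightarrow> R2) \<Rightarrow> bool" where
  "lift_diff F \<longleftrightarrow> bij F \<and> smooth F \<and> smooth (inv F) \<and>
     (\<forall>x k. k \<in> intvecs \<longrightarrow> F (x + k) = F x + k)"

definition area_pres :: "(R2 \<Rightarrow> R2) \<Rightarrow> bool" where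
  "area_pres H \<longleftrightarrow> H \<in> borel_measurable lborel \<and> distr lborel lborel H = lborel"

definition cnorm :: "nat \<Rightarrow> (R2 \<Rightarrow> R2) \<Rightarrow> ereal" where
  "cnorm k \<Phi> = (SUP p \<in> {(vs, x). set vs \<subseteq> Basis \<and> length vs \<le> k}.
                   ereal (norm (pd (fst p) \<Phi> (snd p))))"

definition cdist :: "nat \<Rightarrow> (R2 \<Rightarrow> R2) \<Rightarrow> (R2 \<Rightarrow> R2) \<Rightarrow> ereal" where
  "cdist k F G = cnorm k (\<lambda>x. F x - G x) + cnorm k (\<lambda>x. inv F x - inv G x)"

text \<open>Conjugates of translations (lifts of h o R_theta o h^-1).\<close>
definition conj_rot :: "R2 \<Rightarrow> (R2 \<Rightarrow> R2) \<Rightarrow> (R2 \<Rightarrow> R2)" where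
  "conj_rot \<theta> H = H \<circ> (\<lambda>x. x + \<theta>) \<circ> inv H"

definition Orb :: "(R2 \<Rightarrow> R2) set" where
  "Orb = {conj_rot \<theta> H | \<theta> H. torus_diff_lift H}"

definition Orb_mu :: "(R2 \<Rightarrow> R2) set" where
  "Orb_mu = {conj_rot \<theta> H | \<theta> H. torus_diff_lift H \<and> area_pres H}"

definition Cinf_closure :: "(R2 \<Rightarrow> R2) set \<Rightarrow> (R2 \<Rightarrow> R2) set" where
  "Cinf_closure S = {F. lift_diff F \<and>
      (\<forall>k. \<forall>\<epsilon>>0. \<exists>G\<in>S. cdist k F G < ereal \<epsilon>)}"

definition AK :: "(R2 \<Rightarrow> R2) set" where "AK = Cinf_closure Orb"
definition AK_mu :: "(R2 \<Rightarrow> R2) set" where "AK_mu = Cinf_closure Orb_mu"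

definition Cinf_open_in :: "(R2 \<Rightarrow> R2) set \<Rightarrow> (R2 \<Rightarrow> R2) set \<Rightarrow> bool" where
  "Cinf_open_in A U \<longleftrightarrow> U \<subseteq> A \<and>
     (\<forall>F\<in>U. \<exists>k. \<exists>\<epsilon>>0. {G\<in>A. cdist k F G < ereal \<epsilon>} \<subseteq> U)"

definition Cinf_dense_in :: "(R2 \<Rightarrow> R2) set \<Rightarrow> (R2 \<Rightarrow> R2) set \<Rightarrow> bool" where
  "Cinf_dense_in A U \<longleftrightarrow> (\<forall>F\<in>A. \<forall>k. \<forall>\<epsilon>>0. \<exists>G\<in>U. cdist k F G < ereal \<epsilon>)"

definition generic_in :: "(R2 \<Rightarrow> R2) set \<Rightarrow> ((R2 \<Rightarrow> R2) \<Rightarrow> bool) \<Rightarrow> bool" where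
  "generic_in A P \<longleftrightarrow> (\<exists>U :: nat \<Rightarrow> (R2 \<Rightarrow> R2) set.
      (\<forall>n. Cinf_open_in A (U n) \<and> Cinf_dense_in A (U n)) \<and> (\<forall>F\<in>(\<Inter>n. U n). P F))"

definition hausdorff_conv :: "(nat \<Rightarrow> R2 set) \<Rightarrow> R2 set \<Rightarrow> bool" where
  "hausdorff_conv S K \<longleftrightarrow> compact K \<and> K \<noteq> {} \<and>
     (\<forall>\<epsilon>>0. eventually (\<lambda>i. S i \<subseteq> (\<Union>y\<in>K. ball y \<epsilon>) \<and> K \<subseteq> (\<Union>y\<in>S i. ball y \<epsilon>)) sequentially)"

definition unit_square :: "R2 set" where "unit_square = cbox 0 One"

definition gen_rot_set :: "(R2 \<Rightarrow> R2) \<Rightarrow> R2 \<Rightarrow> R2 set \<Rightarrow> bool" where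
  "gen_rot_set F x0 K \<longleftrightarrow> (\<exists>n :: nat \<Rightarrow> nat.
      filterlim (\<lambda>i. diameter ((F ^^ n i) ` unit_square)) at_top sequentially \<and>
      hausdorff_conv
        (\<lambda>i. (\<lambda>y. (1 / diameter ((F ^^ n i) ` unit_square)) *\<^sub>R (y - (F ^^ n i) x0))
               ` ((F ^^ n i) ` unit_square)) K)"

definition same_homothety_type :: "R2 set \<Rightarrow> R2 set \<Rightarrow> bool" where
  "same_homothety_type K L \<longleftrightarrow> (\<exists>t v. t > 0 \<and> L = (\<lambda>x. t *\<^sub>R x + v) ` K)"

definition point_symmetric :: "R2 set \<Rightarrow> bool" where
  "point_symmetric K \<longleftrightarrow> (\<exists>c. \<forall>x\<in>K. 2 *\<^sub>R c - x \<in> K)"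

definition all_shapes_property :: "R2 \<Rightarrow> (R2 \<Rightarrow> R2) \<Rightarrow> bool" where
  "all_shapes_property x0 F \<longleftrightarrow> (\<forall>K. compact K \<and> convex K \<and> point_symmetric K \<and>
      (\<exists>x\<in>K. \<exists>y\<in>K. x \<noteq> y) \<longrightarrow>
      (\<exists>R. gen_rot_set F x0 R \<and> same_homothety_type R K))"

end

theory Submission
  imports Defs
begin

text \<open>
  For finitely many integer vectors \<open>v\<close> and a precision, the set of \<open>F\<close> with an iterate for which
  \<open>F\<^sup>n D\<close> is, up to translation and relative to its size, close to the zonotope spanned by the
  vectors \<open>v\<close> is open. Since every point-symmetric planar convex body is a limit of rescaled zonotopes of this
  kind, it remains to see that these sets are dense.

  Given \<open>H R\<^sub>\<theta> H\<^sup>-\<^sup>1\<close>, we may take \<open>\<theta> = \<theta>0\<close> with \<open>q \<theta>0\<close> integral. Let \<open>h\<close> be a composition of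
  area-preserving shears \<open>x \<mapsto> x + c sin(2\<pi> l(x)) v\<close> of large amplitude and rapidly increasing frequency which
  commute with \<open>(1/q)\<int>\<^sup>2\<close>. As the frequencies are far apart, the shears move points almost independently,
  and \<open>h R\<^sub>\<gamma> h\<^sup>-\<^sup>1\<close> with \<open>\<gamma>\<close> a half period has displacements filling a large zonotope. The
  map \<open>H h R h\<^sup>-\<^sup>1 H\<^sup>-\<^sup>1\<close> with \<open>R\<close> the rotation by \<open>\<theta>0 + \<gamma>/n\<close> is close to the given one for large \<open>n\<close>,
  and its \<open>n\<close>-th iterate has the displacements of \<open>h R\<^sub>\<gamma> h\<^sup>-\<^sup>1\<close>, transformed by the linear part
  of \<open>H\<close> up to a bounded error.
\<close>

section \<open>Smooth maps and their compositions\<close>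

text \<open>The conflict to resolve is that a conjugacy with large displacements is far from the
  identity, while the new map must stay close to the given one. Since \<open>h\<close> commutes with
  the rotation by \<open>\<theta>0\<close>, inserting it leaves \<open>H R H^-1\<close> unchanged at
  that angle; closeness is then bought only by shrinking \<open>\<gamma>/n\<close>, after
  \<open>h\<close> is fixed. The amplitude \<open>M\<close> can be arbitrarily large because every
  error depends on \<open>H\<close> and the spanning vectors alone: the distance of \<open>H\<close>
  from its linear part, the size of a fundamental domain, and the rounding of coefficients to
  integers. One \<open>\<gamma>\<close> has to be a half period of all shears at once, which is why
  the spanning vectors obey a parity condition. Taking them integral also leaves only countably many
  conditions, and makes the shears move points by deck translations, through which the earlier maps
  pass unchanged. That zonotopes exhaust the symmetric convex bodies is special to the plane, where
  every symmetric polygon is a sum of segments. Shears preserve area, so one construction serves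
  both classes.\<close>

lemma pd_append: "pd (vs @ ws) F = pd vs (pd ws F)"
  by (induction vs) auto

lemma smooth_pd: "smooth F \<Longrightarrow> set ws \<subseteq> Basis \<Longrightarrow> smooth (pd ws F)"
  by (metis (no_types, lifting) pd_append set_append smooth_def le_sup_iff)

lemma smooth_differentiable: "smooth F \<Longrightarrow> F differentiable at x"
  unfolding smooth_def by (metis empty_set empty_subsetI pd.simps(1))

lemma smooth_has_derivative:
  "smooth F \<Longrightarrow> (F has_derivative frechet_derivative F (at x)) (at x)"
  using smooth_differentiable frechet_derivative_works by blast

lemma smooth_continuous_on: "smooth F \<Longrightarrow> continuous_on S F"
  by (meson continuous_at_imp_continuous_on differentiable_imp_continuous_within smooth_differentiable)

lemma smooth_frechet: "smooth F \<Longrightarrow> v \<in> Basis \<Longrightarrow> smooth (\<lambda>x. frechet_derivative F (at x) v)"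
  using smooth_pd[of F "[v]"] by simp

lemma pd_add:
  assumes "smooth F" "smooth G" "set vs \<subseteq> Basis"
  shows "pd vs (\<lambda>x. F x + G x) = (\<lambda>x. pd vs F x + pd vs G x)"
  using assms(3)
proof (induction vs)
  case (Cons v vs)
  show ?case
  proof
    fix x
    have "pd vs F differentiable at x" "pd vs G differentiable at x"
      using Cons assms by (auto simp: smooth_def)
    then have "frechet_derivative (\<lambda>x. pd vs F x + pd vs G x) (at x)
        = (\<lambda>h. frechet_derivative (pd vs F) (at x) h + frechet_derivative (pd vs G) (at x) h)"
      by (intro frechet_derivative_at[symmetric] has_derivative_add) (auto simp: frechet_derivative_works[symmetric])
    with Cons show "pd (v # vs) (\<lambda>x. F x + G x) x = pd (v # vs) F x + pd (v # vs) G x" by simp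
  qed
qed simp

lemma pd_minus:
  assumes "smooth F" "set vs \<subseteq> Basis"
  shows "pd vs (\<lambda>x. - F x) = (\<lambda>x. - pd vs F x)"
  using assms(2)
proof (induction vs)
  case (Cons v vs)
  show ?case
  proof
    fix x
    have "pd vs F differentiable at x" using Cons assms by (auto simp: smooth_def)
    then have "frechet_derivative (\<lambda>x. - pd vs F x) (at x)
        = (\<lambda>h. - frechet_derivative (pd vs F) (at x) h)"
      by (intro frechet_derivative_at[symmetric] has_derivative_minus) (auto simp: frechet_derivative_works[symmetric])
    with Cons show "pd (v # vs) (\<lambda>x. - F x) x = - pd (v # vs) F x" by simp
  qed
qed simp

lemma smooth_add: "smooth F \<Longrightarrow> smooth G \<Longrightarrow> smooth (\<lambda>x. F x + G x)"
  unfolding smooth_def[of "\<lambda>x. F x + G x"] by (auto simp: pd_add) (auto simp: smooth_def)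

lemma smooth_minus: "smooth F \<Longrightarrow> smooth (\<lambda>x. - F x)"
  unfolding smooth_def[of "\<lambda>x. - F x"] by (auto simp: pd_minus) (auto simp: smooth_def)

lemma smooth_diff: "smooth F \<Longrightarrow> smooth G \<Longrightarrow> smooth (\<lambda>x. F x - G x)"
  using smooth_add[OF _ smooth_minus] by auto

lemma pd_diff:
  assumes "smooth F" "smooth G" "set vs \<subseteq> Basis"
  shows "pd vs (\<lambda>x. F x - G x) = (\<lambda>x. pd vs F x - pd vs G x)"
  using pd_add[OF assms(1) smooth_minus[OF assms(2)] assms(3)] pd_minus[OF assms(2,3)]
  by simp

lemma smooth_affine:
  assumes "linear L"
  shows "smooth (\<lambda>x. L x + c)"
proof -
  have D: "((\<lambda>x. L x + c) has_derivative L) (at x)" if "linear L" for L :: "R2 \<Rightarrow> R2" and c x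
    using that by (auto intro!: derivative_eq_intros linear_imp_has_derivative)
  \<comment> \<open>The induction over \<open>vs\<close> needs a class closed under partial
    derivatives: a derivative of an affine map is constant, hence affine with linear part 0.\<close>
  have "\<exists>L c. linear L \<and> pd vs (\<lambda>x. L0 x + c0) = (\<lambda>x. L x + c)" if "linear L0" for vs L0 c0
  proof (induction vs)
    case (Cons v vs)
    then obtain L c where L: "linear L" "pd vs (\<lambda>x. L0 x + c0) = (\<lambda>x. L x + c)" by blast
    have "frechet_derivative (\<lambda>x. L x + c) (at x) = L" for x
      using frechet_derivative_at[OF D[OF L(1)]] by simp
    then have "pd (v # vs) (\<lambda>x. L0 x + c0) = (\<lambda>x. 0 + L v)" using L(2) by simp
    then show ?case using linear_zero by (intro exI[of _ "\<lambda>x. 0"] exI[of _ "L v"]) auto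
  qed (use that in auto)
  then show ?thesis unfolding smooth_def using assms D by (metis differentiableI)
qed

text \<open>Differentiating along \<open>w\<close> advances the phase by pi/2 and multiplies
  \<open>v\<close> by \<open>l w\<close>, so maps of this form are closed under partial
  derivatives.\<close>

lemma smooth_sin:
  assumes "linear (l :: R2 \<Rightarrow> real)"
  shows "smooth (\<lambda>x. sin (l x + s) *\<^sub>R v)"
proof -
  have D: "((\<lambda>x. sin (l x + s) *\<^sub>R v) has_derivative (\<lambda>h. sin (l x + (s + pi/2)) *\<^sub>R (l h *\<^sub>R v))) (at x)" for s v x
    using linear_imp_has_derivative[OF assms]
    by (auto intro!: derivative_eq_intros simp: sin_add cos_add algebra_simps)
  have "\<exists>s v. pd vs (\<lambda>x. sin (l x + s0) *\<^sub>R v0) = (\<lambda>x. sin (l x + s) *\<^sub>R v)" for vs s0 v0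
  proof (induction vs)
    case (Cons w vs)
    then obtain s v where L: "pd vs (\<lambda>x. sin (l x + s0) *\<^sub>R v0) = (\<lambda>x. sin (l x + s) *\<^sub>R v)" by blast
    have "frechet_derivative (\<lambda>x. sin (l x + s) *\<^sub>R v) (at x) w = sin (l x + (s + pi/2)) *\<^sub>R (l w *\<^sub>R v)" for x
      using frechet_derivative_at[OF D] by metis
    then have "pd (w # vs) (\<lambda>x. sin (l x + s0) *\<^sub>R v0) = (\<lambda>x. sin (l x + (s + pi/2)) *\<^sub>R (l w *\<^sub>R v))" using L by simp
    then show ?case by blast
  qed auto
  then show ?thesis unfolding smooth_def using D by (metis differentiableI)
qed

text \<open>Contains the conjugates \<open>conj_rot \<theta> H\<close> (with \<open>P = inv H\<close>) and is closed under partial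
  derivatives in \<open>x\<close> by the chain rule; its members being jointly continuous in \<open>(\<theta>, x)\<close>, all
  derivatives of a conjugate depend continuously on \<open>\<theta>\<close>.\<close>

inductive comp_class :: "(R2 \<Rightarrow> R2) \<Rightarrow> (R2 \<Rightarrow> R2 \<Rightarrow> R2) \<Rightarrow> bool" for P where
  comp: "smooth A \<Longrightarrow> comp_class P (\<lambda>\<theta> x. A (P x + \<theta>))"
| scale: "smooth B \<Longrightarrow> comp_class P g \<Longrightarrow> comp_class P (\<lambda>\<theta> x. (B x \<bullet> b) *\<^sub>R g \<theta> x)"
| add: "comp_class P g \<Longrightarrow> comp_class P g' \<Longrightarrow> comp_class P (\<lambda>\<theta> x. g \<theta> x + g' \<theta> x)"

lemma comp_class_sum:
  "finite I \<Longrightarrow> (\<And>i. i \<in> I \<Longrightarrow> comp_class P (g i)) \<Longrightarrow> comp_class P (\<lambda>\<theta> x. \<Sum>i\<in>I. g i \<theta> x)"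
proof (induction I rule: finite_induct)
  case empty
  have "smooth (\<lambda>x. 0)" using smooth_affine[OF linear_zero, of 0] by simp
  from comp_class.comp[OF this] show ?case by simp
next
  case (insert i I)
  then show ?case using comp_class.add[of P "g i" "\<lambda>\<theta> x. \<Sum>i\<in>I. g i \<theta> x"] by simp
qed

lemma comp_class_differentiable:
  assumes "comp_class P g" "smooth P"
  shows "g \<theta> differentiable at x"
  using assms(1)
proof induction
  case (comp A)
  have "((\<lambda>x. P x + \<theta>) has_derivative frechet_derivative P (at x)) (at x)"
    using smooth_has_derivative[OF assms(2)] by (auto intro!: derivative_eq_intros)
  from has_derivative_compose[OF this smooth_has_derivative[OF comp]]
  show ?case using differentiableI by blast
next
  case (scale B g b)
  then show ?case
    using smooth_differentiable[OF scale(1)] differentiable_inner[of B x UNIV "\<lambda>x. b"]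
    by (auto intro!: differentiable_scaleR)
next
  case (add g g')
  then show ?case by (simp add: differentiable_add)
qed

lemma comp_class_continuous:
  assumes "comp_class P g" "smooth P"
  shows "continuous_on UNIV (\<lambda>p. g (fst p) (snd p))"
  using assms(1)
proof induction
  case (comp A)
  show ?case
    by (rule continuous_on_compose2[OF smooth_continuous_on[OF comp, of UNIV]])
       (auto intro!: continuous_intros continuous_on_compose2[OF smooth_continuous_on[OF assms(2), of UNIV]])
next
  case (scale B g b)
  then show ?case
    by (auto intro!: continuous_intros continuous_on_compose2[OF smooth_continuous_on[OF scale(1), of UNIV]])
next
  case (add g g')
  then show ?case by (simp add: continuous_on_add)
qed

text \<open>The coefficients in the chain rule are components of the derivative of \<open>P\<close>.
  As \<open>smooth\<close> speaks of plane-valued maps, they enter \<open>comp_class\<close> in the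
  form \<open>B x \<bullet> b\<close> and not as scalar functions.\<close>

lemma comp_class_frechet:
  assumes "comp_class P g" "smooth P" "v \<in> Basis"
  shows "comp_class P (\<lambda>\<theta> x. frechet_derivative (g \<theta>) (at x) v)"
  using assms(1)
proof induction
  case (comp A)
  have eq: "frechet_derivative (\<lambda>x. A (P x + \<theta>)) (at x) v
      = (\<Sum>b\<in>Basis. (frechet_derivative P (at x) v \<bullet> b) *\<^sub>R frechet_derivative A (at (P x + \<theta>)) b)"
    for \<theta> x
  proof -
    have "((\<lambda>x. P x + \<theta>) has_derivative frechet_derivative P (at x)) (at x)"
      using smooth_has_derivative[OF assms(2)] by (auto intro!: derivative_eq_intros)
    from has_derivative_compose[OF this smooth_has_derivative[OF comp]]
    have "frechet_derivative (\<lambda>x. A (P x + \<theta>)) (at x) v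
        = frechet_derivative A (at (P x + \<theta>)) (frechet_derivative P (at x) v)"
      using frechet_derivative_at by metis
    also have "\<dots> = (\<Sum>b\<in>Basis. (frechet_derivative P (at x) v \<bullet> b) *\<^sub>R frechet_derivative A (at (P x + \<theta>)) b)"
    proof -
      have L: "linear (frechet_derivative A (at (P x + \<theta>)))"
        using smooth_has_derivative[OF comp] has_derivative_linear by blast
      have "frechet_derivative A (at (P x + \<theta>)) w
          = (\<Sum>b\<in>Basis. (w \<bullet> b) *\<^sub>R frechet_derivative A (at (P x + \<theta>)) b)" for w
        by (subst euclidean_representation[of w, symmetric]) (simp only: linear_sum[OF L] linear_cmul[OF L])
      then show ?thesis .
    qed
    finally show ?thesis .
  qed
  show ?case unfolding eq
    by (intro comp_class_sum finite_Basis comp_class.scale[OF smooth_frechet[OF assms(2,3)]]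
        comp_class.comp smooth_frechet[OF comp])
next
  case (scale B g b)
  have eq: "frechet_derivative (\<lambda>x. (B x \<bullet> b) *\<^sub>R g \<theta> x) (at x) v
      = (B x \<bullet> b) *\<^sub>R frechet_derivative (g \<theta>) (at x) v + (frechet_derivative B (at x) v \<bullet> b) *\<^sub>R g \<theta> x"
    for \<theta> x
  proof -
    have "((\<lambda>x. (B x \<bullet> b) *\<^sub>R g \<theta> x) has_derivative
        (\<lambda>h. (B x \<bullet> b) *\<^sub>R frechet_derivative (g \<theta>) (at x) h + (frechet_derivative B (at x) h \<bullet> b) *\<^sub>R g \<theta> x)) (at x)"
      using smooth_has_derivative[OF scale(1), of x]
        comp_class_differentiable[OF scale(2) assms(2), of \<theta> x, unfolded frechet_derivative_works]
      by (auto intro!: derivative_eq_intros)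
    from fun_cong[OF frechet_derivative_at[OF this], of v] show ?thesis by (rule sym)
  qed
  show ?case unfolding eq
    by (intro comp_class.add comp_class.scale[OF scale(1) scale(3)]
        comp_class.scale[OF smooth_frechet[OF scale(1) assms(3)] scale(2)])
next
  case (add g g')
  have "frechet_derivative (\<lambda>x. g \<theta> x + g' \<theta> x) (at x) v
     = frechet_derivative (g \<theta>) (at x) v + frechet_derivative (g' \<theta>) (at x) v" for \<theta> x
  proof -
    have "((\<lambda>x. g \<theta> x + g' \<theta> x) has_derivative
      (\<lambda>h. frechet_derivative (g \<theta>) (at x) h + frechet_derivative (g' \<theta>) (at x) h)) (at x)"
      using comp_class_differentiable[OF add(1) assms(2), of \<theta> x, unfolded frechet_derivative_works]
        comp_class_differentiable[OF add(2) assms(2), of \<theta> x, unfolded frechet_derivative_works]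
      by (rule has_derivative_add)
    from fun_cong[OF frechet_derivative_at[OF this], of v] show ?thesis by (rule sym)
  qed
  then show ?case using add by (simp add: comp_class.add)
qed

lemma comp_class_pd:
  assumes "comp_class P g" "smooth P" "set vs \<subseteq> Basis"
  shows "comp_class P (\<lambda>\<theta>. pd vs (g \<theta>))"
  using assms(3)
proof (induction vs)
  case Nil
  then show ?case using assms by simp
next
  case (Cons v vs)
  then show ?case using comp_class_frechet[OF _ assms(2), of "\<lambda>\<theta>. pd vs (g \<theta>)" v] by simp
qed

lemma comp_class_smooth: "comp_class P g \<Longrightarrow> smooth P \<Longrightarrow> smooth (g \<theta>)"
  unfolding smooth_def[of "g \<theta>"]
  using comp_class_pd comp_class_differentiable[of P "\<lambda>\<theta>. pd _ (g \<theta>)"] by auto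

lemma smooth_comp: "smooth A \<Longrightarrow> smooth P \<Longrightarrow> smooth (A \<circ> P)"
  using comp_class_smooth[OF comp_class.comp, of A P 0] by (simp add: o_def)

lemma smooth_id: "smooth (\<lambda>x. x)"
  using smooth_affine[OF linear_id, of 0] by (simp add: id_def)

lemma pd_zero: "set vs \<subseteq> Basis \<Longrightarrow> pd vs (\<lambda>x. 0) = (\<lambda>x. 0)"
  using pd_diff[OF smooth_id smooth_id, of vs] by simp

section \<open>The distances and conjugates of translations\<close>

lemma intvecs_minus: "k \<in> intvecs \<Longrightarrow> - k \<in> intvecs"
  by (auto simp: intvecs_def)

lemma intvecs_scale: "k \<in> intvecs \<Longrightarrow> of_int m *\<^sub>R k \<in> intvecs"
  by (auto simp: intvecs_def)

lemma intvecs_zero [simp]: "0 \<in> intvecs"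
  by (auto simp: intvecs_def)

lemma mem_unit_square: "x \<in> unit_square \<longleftrightarrow> (\<forall>i. 0 \<le> x $ i \<and> x $ i \<le> 1)"
proof -
  have "(One :: R2) $ i = 1" for i
    by (simp add: cart_eq_inner_axis axis_in_Basis_iff)
  then show ?thesis by (simp add: unit_square_def mem_box_cart)
qed

lemma compact_unit_square: "compact unit_square"
  by (simp add: unit_square_def)

lemma unit_square_cover: "\<exists>k\<in>intvecs. x - k \<in> unit_square"
proof
  let ?k = "(\<chi> i. of_int \<lfloor>x $ i\<rfloor>) :: R2"
  show "?k \<in> intvecs" by (simp add: intvecs_def)
  show "x - ?k \<in> unit_square" by (auto simp: mem_unit_square) linarith+
qed

text \<open>Both sides choose their derivative from the same set of candidates, so the identity
  covers points without a derivative as well.\<close>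

lemma pd_shift: "pd vs (\<lambda>x. F (x + k)) = (\<lambda>x. pd vs F (x + k))"
proof (induction vs)
  case (Cons v vs)
  have sh: "((\<lambda>x. f (x + k)) has_derivative D) (at x) \<longleftrightarrow> (f has_derivative D) (at (x + k))"
    for f :: "R2 \<Rightarrow> R2" and D x
  proof
    assume "(f has_derivative D) (at (x + k))"
    then show "((\<lambda>x. f (x + k)) has_derivative D) (at x)"
      by (intro has_derivative_compose[of "\<lambda>x. x + k" "\<lambda>h. h" x UNIV f D])
         (auto intro!: derivative_eq_intros)
  next
    assume "((\<lambda>x. f (x + k)) has_derivative D) (at x)"
    moreover have "((\<lambda>x. x - k) has_derivative (\<lambda>h. h)) (at (x + k))"
      by (auto intro!: derivative_eq_intros)
    ultimately show "(f has_derivative D) (at (x + k))"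
      using has_derivative_compose[of "\<lambda>x. x - k" "\<lambda>h. h" "x + k" UNIV "\<lambda>x. f (x + k)" D] by simp
  qed
  show ?case by (simp add: Cons frechet_derivative_def sh)
qed simp

section \<open>The C^k norms and distances\<close>

lemma cnorm_le:
  assumes "\<And>vs x. set vs \<subseteq> Basis \<Longrightarrow> length vs \<le> k \<Longrightarrow> norm (pd vs F x) \<le> e"
  shows "cnorm k F \<le> ereal e"
  unfolding cnorm_def using assms by (auto intro!: SUP_least)

lemma norm_pd_le_cnorm:
  "set vs \<subseteq> Basis \<Longrightarrow> length vs \<le> k \<Longrightarrow> ereal (norm (pd vs F x)) \<le> cnorm k F"
  unfolding cnorm_def by (rule SUP_upper2[where i="(vs, x)"]) auto

lemma cnorm_nonneg: "0 \<le> cnorm k F"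
proof -
  have "0 \<le> ereal (norm (pd [] F 0))" by simp
  also have "\<dots> \<le> cnorm k F" by (rule norm_pd_le_cnorm) auto
  finally show ?thesis .
qed

lemma cnorm_triangle:
  assumes "smooth F" "smooth G"
  shows "cnorm k (\<lambda>x. F x + G x) \<le> cnorm k F + cnorm k G"
proof -
  have "ereal (norm (pd vs (\<lambda>x. F x + G x) x)) \<le> cnorm k F + cnorm k G"
    if "set vs \<subseteq> Basis" "length vs \<le> k" for vs x
  proof -
    have "ereal (norm (pd vs (\<lambda>x. F x + G x) x)) \<le> ereal (norm (pd vs F x)) + ereal (norm (pd vs G x))"
      using that assms by (simp add: pd_add norm_triangle_ineq)
    also have "\<dots> \<le> cnorm k F + cnorm k G"
      by (intro add_mono norm_pd_le_cnorm that)
    finally show ?thesis .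
  qed
  then show ?thesis unfolding cnorm_def[of k "\<lambda>x. F x + G x"] by (auto intro!: SUP_least)
qed

lemma cdist_triangle:
  assumes "smooth F" "smooth G" "smooth H" "smooth (inv F)" "smooth (inv G)" "smooth (inv H)"
  shows "cdist k F H \<le> cdist k F G + cdist k G H"
proof -
  have "cnorm k (\<lambda>x. F x - H x) \<le> cnorm k (\<lambda>x. F x - G x) + cnorm k (\<lambda>x. G x - H x)"
    using cnorm_triangle[OF smooth_diff[OF assms(1,2)] smooth_diff[OF assms(2,3)], of k] by simp
  moreover have "cnorm k (\<lambda>x. inv F x - inv H x)
      \<le> cnorm k (\<lambda>x. inv F x - inv G x) + cnorm k (\<lambda>x. inv G x - inv H x)"
    using cnorm_triangle[OF smooth_diff[OF assms(4,5)] smooth_diff[OF assms(5,6)], of k] by simp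
  ultimately have "cdist k F H \<le> (cnorm k (\<lambda>x. F x - G x) + cnorm k (\<lambda>x. G x - H x))
     + (cnorm k (\<lambda>x. inv F x - inv G x) + cnorm k (\<lambda>x. inv G x - inv H x))"
    unfolding cdist_def by (rule add_mono)
  then show ?thesis by (simp add: cdist_def ac_simps)
qed

lemma cnorm_zero: "cnorm k (\<lambda>x. 0) = 0"
  by (rule antisym[OF _ cnorm_nonneg]) (auto simp: pd_zero zero_ereal_def intro!: cnorm_le)

lemma cdist_self: "cdist k F F = 0"
  by (simp add: cdist_def cnorm_zero)

lemma cdist_norm_le:
  assumes "cdist k F G < ereal e"
  shows "norm (F x - G x) < e"
proof -
  have "ereal (norm (F x - G x)) \<le> cnorm k (\<lambda>x. F x - G x)"
    using norm_pd_le_cnorm[of "[]" k "\<lambda>x. F x - G x" x] by simp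
  also have "\<dots> \<le> cdist k F G"
    unfolding cdist_def using cnorm_nonneg by (simp add: ereal_le_add_self)
  finally show ?thesis using assms by (metis ereal_less(2) le_less_trans less_ereal.simps(1))
qed

lemma integer_valued_constant:
  assumes "continuous_on UNIV (f :: R2 \<Rightarrow> R2)" "\<And>x. f x \<in> intvecs"
  shows "f x = f y"
proof -
  have "f x $ i = f y $ i" for i
  proof -
    have "(\<lambda>x. f x $ i) constant_on UNIV"
    proof (rule continuous_discrete_range_constant)
      show "connected (UNIV :: R2 set)" by (rule connected_UNIV)
      show "continuous_on UNIV (\<lambda>x. f x $ i)" by (intro continuous_intros assms)
      fix x :: R2
      show "\<exists>e>0. \<forall>y. y \<in> UNIV \<and> f y $ i \<noteq> f x $ i \<longrightarrow> e \<le> norm (f y $ i - f x $ i)"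
      proof (intro exI[of _ 1] conjI allI impI)
        fix y assume "y \<in> UNIV \<and> f y $ i \<noteq> f x $ i"
        moreover have "f y $ i - f x $ i \<in> \<int>" using assms(2) by (auto simp: intvecs_def)
        ultimately show "1 \<le> norm (f y $ i - f x $ i)"
          by (metis Ints_nonzero_abs_ge1 eq_iff_diff_eq_0 real_norm_def)
      qed simp
    qed
    then show ?thesis by (auto simp: constant_on_def)
  qed
  then show ?thesis by (simp add: vec_eq_iff)
qed

text \<open>The integer vector by which \<open>H\<close> answers a deck translation depends
  continuously on the point. Its constancy is what gives \<open>H\<close> an action on the
  lattice.\<close>

lemma torus_diff_lift_shift:
  assumes "torus_diff_lift H" "k \<in> intvecs"
  shows "H (x + k) - H x = H (y + k) - H y"
proof (rule integer_valued_constant[of "\<lambda>x. H (x + k) - H x"])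
  have "smooth H" using assms by (simp add: torus_diff_lift_def)
  then show "continuous_on UNIV (\<lambda>x. H (x + k) - H x)"
    by (intro continuous_on_diff smooth_continuous_on[of H]
      continuous_on_compose2[OF smooth_continuous_on[of H UNIV]] continuous_intros) auto
qed (use assms in \<open>auto simp: torus_diff_lift_def\<close>)

section \<open>Conjugates of translations\<close>

lemma conj_rot_smooth: "torus_diff_lift H \<Longrightarrow> smooth (conj_rot \<theta> H)"
  using comp_class_smooth[OF comp_class.comp, of H "inv H" \<theta>]
  by (simp add: torus_diff_lift_def conj_rot_def o_def)

lemma conj_rot_compose:
  assumes "bij H"
  shows "conj_rot \<theta> H \<circ> conj_rot \<theta>' H = conj_rot (\<theta>' + \<theta>) H"
  using assms by (auto simp: conj_rot_def o_def bij_is_inj add.assoc)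

lemma conj_rot_zero: "bij H \<Longrightarrow> conj_rot 0 H = id"
  by (auto simp: conj_rot_def o_def bij_is_surj surj_f_inv_f)

lemma bij_conj_rot: "bij H \<Longrightarrow> bij (conj_rot \<theta> H)"
  using conj_rot_compose[of H \<theta> "- \<theta>"] conj_rot_compose[of H "- \<theta>" \<theta>]
  by (intro o_bij) (auto simp: conj_rot_zero)

lemma inv_conj_rot:
  assumes "bij H"
  shows "inv (conj_rot \<theta> H) = conj_rot (- \<theta>) H"
  using conj_rot_compose[OF assms, of \<theta> "- \<theta>"] conj_rot_compose[OF assms, of "- \<theta>" \<theta>]
  by (intro inv_unique_comp) (auto simp: conj_rot_zero assms)

lemma conj_rot_funpow: "bij H \<Longrightarrow> conj_rot \<theta> H ^^ n = conj_rot (real n *\<^sub>R \<theta>) H"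
  by (induction n) (auto simp: conj_rot_zero conj_rot_compose scaleR_add_left add.commute id_def)

text \<open>\<open>H\<close> may act on the lattice by a nontrivial matrix, but the conjugate does
  not: \<open>inv H\<close> turns \<open>k\<close> into \<open>m\<close>, and \<open>H\<close> turns
  \<open>m\<close> back into \<open>k\<close>, at \<open>y + \<theta>\<close> just as at
  \<open>y\<close>.\<close>

lemma conj_rot_periodic:
  assumes "torus_diff_lift H" "k \<in> intvecs"
  shows "conj_rot \<theta> H (x + k) = conj_rot \<theta> H x + k"
proof -
  define y m where "y = inv H x" and "m = inv H (x + k) - inv H x"
  have bij: "bij H" using assms by (simp add: torus_diff_lift_def)
  have m: "m \<in> intvecs" using assms by (simp add: torus_diff_lift_def m_def)
  have "H (y + m) - H y = k"
    by (simp add: y_def m_def bij_is_surj[OF bij] surj_f_inv_f)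
  then have "H (y + \<theta> + m) - H (y + \<theta>) = k"
    using torus_diff_lift_shift[OF assms(1) m] by metis
  then have "H (inv H (x + k) + \<theta>) = H (inv H x + \<theta>) + k"
    by (simp add: y_def m_def algebra_simps)
  then show ?thesis by (simp add: conj_rot_def)
qed

lemma lift_diff_conj_rot: "torus_diff_lift H \<Longrightarrow> lift_diff (conj_rot \<theta> H)"
  using conj_rot_periodic conj_rot_smooth inv_conj_rot bij_conj_rot
  by (auto simp: lift_diff_def torus_diff_lift_def)

text \<open>The difference of two conjugates is periodic, so the supremum over the plane reduces to
  the unit square. With angles in a closed ball this is a compact set, where joint continuity is
  uniform; there are finitely many \<open>vs\<close> to treat.\<close>

lemma cnorm_conj_rot_continuous:
  assumes "torus_diff_lift H" "e > 0"
  shows "\<exists>d>0. \<forall>\<theta>. norm (\<theta> - \<theta>0) < d \<longrightarrow> cnorm k (\<lambda>x. conj_rot \<theta> H x - conj_rot \<theta>0 H x) \<le> ereal e"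
proof -
  define S where "S = {vs :: R2 list. set vs \<subseteq> Basis \<and> length vs \<le> k}"
  have finS: "finite S" unfolding S_def by (intro finite_lists_length_le finite_Basis)
  have sm: "smooth H" "smooth (inv H)" using assms by (auto simp: torus_diff_lift_def)
  have cl: "comp_class (inv H) (\<lambda>\<theta>. conj_rot \<theta> H)"
    using comp_class.comp[OF sm(1), of "inv H"] by (simp add: conj_rot_def o_def)
  have ex: "\<exists>d>0. \<forall>\<theta> x. norm (\<theta> - \<theta>0) < d \<longrightarrow> norm (pd vs (conj_rot \<theta> H) x - pd vs (conj_rot \<theta>0 H) x) \<le> e"
    if "vs \<in> S" for vs
  proof -
    have vs: "set vs \<subseteq> Basis" using that by (simp add: S_def)
    let ?g = "\<lambda>p. pd vs (conj_rot (fst p) H) (snd p)"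
    have "continuous_on (cball \<theta>0 1 \<times> unit_square) ?g"
      using comp_class_continuous[OF comp_class_pd[OF cl sm(2) vs] sm(2)]
      by (rule continuous_on_subset) auto
    then have "uniformly_continuous_on (cball \<theta>0 1 \<times> unit_square) ?g"
      by (intro compact_uniformly_continuous compact_Times compact_cball compact_unit_square)
    then obtain d where d: "d > 0" "\<And>p p'. p \<in> cball \<theta>0 1 \<times> unit_square \<Longrightarrow>
        p' \<in> cball \<theta>0 1 \<times> unit_square \<Longrightarrow> dist p' p < d \<Longrightarrow> dist (?g p') (?g p) < e"
      unfolding uniformly_continuous_on_def using assms(2) by metis
    have "norm (pd vs (conj_rot \<theta> H) x - pd vs (conj_rot \<theta>0 H) x) \<le> e"
      if "norm (\<theta> - \<theta>0) < min d 1" for \<theta> x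
    proof -
      obtain l where l: "l \<in> intvecs" "x - l \<in> unit_square" using unit_square_cover by blast
      have sh: "pd vs (conj_rot \<theta> H) x - pd vs (conj_rot \<theta>0 H) x
        = pd vs (conj_rot \<theta> H) (x - l) - pd vs (conj_rot \<theta>0 H) (x - l)"
      proof -
        let ?D = "\<lambda>x. conj_rot \<theta> H x - conj_rot \<theta>0 H x"
        have D: "pd vs ?D = (\<lambda>x. pd vs (conj_rot \<theta> H) x - pd vs (conj_rot \<theta>0 H) x)"
          by (intro pd_diff conj_rot_smooth assms vs)
        have "pd vs ?D (y + l) = pd vs (\<lambda>x. ?D (x + l)) y" for y
          by (rule fun_cong[OF pd_shift[symmetric]])
        also have "(\<lambda>x. ?D (x + l)) = ?D" by (simp add: conj_rot_periodic[OF assms(1) l(1)])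
        finally have "pd vs ?D (y + l) = pd vs ?D y" for y .
        from this[of "x - l"] show ?thesis unfolding D by simp
      qed
      have "dist (\<theta>, x - l) (\<theta>0, x - l) < d"
        using that by (simp add: dist_Pair_Pair dist_norm)
      from d(2)[OF _ _ this] show ?thesis
        unfolding sh using that l(2) by (auto simp: dist_norm norm_minus_commute)
    qed
    then show ?thesis using d(1) by (intro exI[of _ "min d 1"]) auto
  qed
  from ex obtain d where d: "\<And>vs. vs \<in> S \<Longrightarrow> d vs > 0"
    "\<And>vs \<theta> x. vs \<in> S \<Longrightarrow> norm (\<theta> - \<theta>0) < d vs \<Longrightarrow> norm (pd vs (conj_rot \<theta> H) x - pd vs (conj_rot \<theta>0 H) x) \<le> e"
    by metis
  have "S \<noteq> {}" unfolding S_def by (auto intro!: exI[of _ "[]"])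
  define m where "m = Min (d ` S)"
  have "m > 0" unfolding m_def using finS \<open>S \<noteq> {}\<close> d(1) by auto
  moreover have m_le: "m \<le> d vs" if "vs \<in> S" for vs unfolding m_def using finS that by auto
  moreover have "cnorm k (\<lambda>x. conj_rot \<theta> H x - conj_rot \<theta>0 H x) \<le> ereal e"
    if "norm (\<theta> - \<theta>0) < m" for \<theta>
  proof (rule cnorm_le)
    fix vs x assume vs: "set vs \<subseteq> (Basis :: R2 set)" "length vs \<le> k"
    then have "vs \<in> S" by (simp add: S_def)
    then show "norm (pd vs (\<lambda>x. conj_rot \<theta> H x - conj_rot \<theta>0 H x) x) \<le> e"
      using d(2)[of vs \<theta> x] m_le[OF \<open>vs \<in> S\<close>] that vs(1)
      by (simp add: pd_diff conj_rot_smooth[OF assms(1)])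
  qed
  ultimately show ?thesis by blast
qed

lemma cdist_conj_rot_continuous:
  assumes "torus_diff_lift H" "e > 0"
  shows "\<exists>d>0. \<forall>\<theta>. norm (\<theta> - \<theta>0) < d \<longrightarrow> cdist k (conj_rot \<theta>0 H) (conj_rot \<theta> H) < ereal e"
proof -
  have bij: "bij H" using assms by (simp add: torus_diff_lift_def)
  \<comment> \<open>Each half of \<open>cdist\<close> is made at most e/3, since the bounds are weak
    and their sum must be strictly less than e. The half for the inverses is the same estimate at
    the opposite angle.\<close>
  obtain d1 where d1: "d1 > 0" "\<And>\<theta>. norm (\<theta> - \<theta>0) < d1 \<Longrightarrow>
      cnorm k (\<lambda>x. conj_rot \<theta> H x - conj_rot \<theta>0 H x) \<le> ereal (e/3)"
    using cnorm_conj_rot_continuous[OF assms(1), of "e/3"] assms(2) by (metis divide_pos_pos zero_less_numeral)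
  obtain d2 where d2: "d2 > 0" "\<And>\<theta>. norm (\<theta> - (- \<theta>0)) < d2 \<Longrightarrow>
      cnorm k (\<lambda>x. conj_rot \<theta> H x - conj_rot (- \<theta>0) H x) \<le> ereal (e/3)"
    using cnorm_conj_rot_continuous[OF assms(1), of "e/3"] assms(2) by (metis divide_pos_pos zero_less_numeral)
  have cn: "cnorm k (\<lambda>x. F x - G x) = cnorm k (\<lambda>x. G x - F x)" if "smooth F" "smooth G" for F G
  proof -
    have "norm (pd (fst p) (\<lambda>x. F x - G x) (snd p)) = norm (pd (fst p) (\<lambda>x. G x - F x) (snd p))"
      if "p \<in> {(vs, x). set vs \<subseteq> Basis \<and> length vs \<le> k}" for p
      using that \<open>smooth F\<close> \<open>smooth G\<close> by (auto simp: pd_diff norm_minus_commute)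
    then show ?thesis unfolding cnorm_def by (metis (no_types, lifting) SUP_cong)
  qed
  have "cdist k (conj_rot \<theta>0 H) (conj_rot \<theta> H) < ereal e" if "norm (\<theta> - \<theta>0) < min d1 d2" for \<theta>
  proof -
    have "cnorm k (\<lambda>x. conj_rot \<theta>0 H x - conj_rot \<theta> H x) \<le> ereal (e/3)"
      using d1(2)[of \<theta>] that cn[OF conj_rot_smooth conj_rot_smooth, OF assms(1) assms(1)] by auto
    moreover have "cnorm k (\<lambda>x. conj_rot (-\<theta>0) H x - conj_rot (-\<theta>) H x) \<le> ereal (e/3)"
      using d2(2)[of "- \<theta>"] that cn[OF conj_rot_smooth conj_rot_smooth, OF assms(1) assms(1), of "-\<theta>0" "-\<theta>"]
      by (auto simp: norm_minus_commute)
    ultimately have "cdist k (conj_rot \<theta>0 H) (conj_rot \<theta> H) \<le> ereal (e/3) + ereal (e/3)"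
      unfolding cdist_def inv_conj_rot[OF bij] by (rule add_mono)
    also have "\<dots> < ereal e" using assms(2) by simp
    finally show ?thesis .
  qed
  then show ?thesis using d1(1) d2(1) by (intro exI[of _ "min d1 d2"]) auto
qed

section \<open>The linear part of a torus diffeomorphism\<close>

lemma linear_from_intvecs:
  assumes add: "\<And>k l. k \<in> intvecs \<Longrightarrow> l \<in> intvecs \<Longrightarrow> a (k + l) = a k + (a l :: R2)"
  shows "\<exists>A. linear A \<and> (\<forall>k\<in>intvecs. A k = a k)"
proof -
  define A where "A = (\<lambda>x::R2. x $ 1 *\<^sub>R a (axis 1 1) + x $ 2 *\<^sub>R a (axis 2 1))"
  have lin: "linear A"
    by (rule linearI) (simp_all add: A_def algebra_simps)
  have ax: "axis i 1 \<in> intvecs" for i :: 2 by (auto simp: intvecs_def axis_def)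
  have a0: "a 0 = 0" using add[of 0 0] by simp
  have a_neg: "a (- k) = - a k" if "k \<in> intvecs" for k
    using add[OF that intvecs_minus[OF that]] a0 by (simp add: eq_neg_iff_add_eq_0 add.commute)
  have nat: "a (real n *\<^sub>R k) = real n *\<^sub>R a k" if "k \<in> intvecs" for n k
  proof (induction n)
    case (Suc n)
    have "real n *\<^sub>R k \<in> intvecs" using intvecs_scale[OF that, of "int n"] by simp
    then show ?case using Suc add[OF _ that, of "real n *\<^sub>R k"] by (simp add: algebra_simps)
  qed (simp add: a0)
  have int: "a (of_int m *\<^sub>R k) = of_int m *\<^sub>R a k" if "k \<in> intvecs" for m k
  proof (cases m)
    case (nonneg n)
    then show ?thesis using nat[OF that] by simp
  next
    case (neg n)
    have "real (Suc n) *\<^sub>R k \<in> intvecs" using intvecs_scale[OF that, of "int (Suc n)"] by simp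
    from a_neg[OF this] show ?thesis using nat[OF that, of "Suc n"] by (simp add: neg del: of_nat_Suc)
  qed
  have "A k = a k" if k: "k \<in> intvecs" for k
  proof -
    from k obtain m n where mn: "k $ 1 = of_int m" "k $ 2 = of_int n"
      by (auto simp: intvecs_def elim!: Ints_cases) (metis Ints_cases)
    have "k = of_int m *\<^sub>R axis 1 1 + of_int n *\<^sub>R axis 2 1"
      by (simp add: vec_eq_iff forall_2 mn axis_def)
    then have "a k = a (of_int m *\<^sub>R axis 1 1 + of_int n *\<^sub>R axis 2 1)" by (rule arg_cong)
    also have "\<dots> = of_int m *\<^sub>R a (axis 1 1) + of_int n *\<^sub>R a (axis 2 1)"
      by (simp only: add[OF intvecs_scale[OF ax] intvecs_scale[OF ax]] int[OF ax])
    finally show ?thesis by (simp add: A_def mn)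
  qed
  with lin show ?thesis by blast
qed

lemma linear_eq_on_intvecs:
  assumes "linear A" "linear B" "\<And>k. k \<in> intvecs \<Longrightarrow> A k = (B k :: R2)"
  shows "A x = B x"
proof -
  have ax: "axis i 1 \<in> intvecs" for i :: 2 by (auto simp: intvecs_def axis_def)
  have x: "x = x $ 1 *\<^sub>R axis 1 1 + x $ 2 *\<^sub>R axis 2 1"
    by (simp add: vec_eq_iff forall_2 axis_def)
  have "A (x $ 1 *\<^sub>R axis 1 1 + x $ 2 *\<^sub>R axis 2 1) = B (x $ 1 *\<^sub>R axis 1 1 + x $ 2 *\<^sub>R axis 2 1)"
    by (simp only: linear_add[OF assms(1)] linear_cmul[OF assms(1)] linear_add[OF assms(2)]
        linear_cmul[OF assms(2)] assms(3)[OF ax])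
  then show ?thesis by (simp only: x[symmetric])
qed

text \<open>\<open>A\<close> and \<open>B\<close> extend the actions of \<open>H\<close> and
  \<open>inv H\<close> on the deck group; being mutually inverse on \<open>intvecs\<close>, they are
  so on its span. The difference of \<open>H\<close> and \<open>A\<close> is periodic, hence bounded
  by its values on the unit square.\<close>

lemma torus_diff_lift_linear_part:
  assumes "torus_diff_lift H"
  obtains A B C where "linear A" "linear B" "\<And>x. A (B x) = x" "\<And>x. B (A x) = x"
    "\<And>k. k \<in> intvecs \<Longrightarrow> A k \<in> intvecs" "\<And>k. k \<in> intvecs \<Longrightarrow> B k \<in> intvecs"
    "\<And>x k. k \<in> intvecs \<Longrightarrow> H (x + k) = H x + A k"
    "\<And>x k. k \<in> intvecs \<Longrightarrow> inv H (x + k) = inv H x + B k"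
    "\<And>x. norm (H x - A x) \<le> C"
proof -
  have sm: "smooth H" "smooth (inv H)" and bij: "bij H"
    using assms by (auto simp: torus_diff_lift_def)
  have inv: "torus_diff_lift (inv H)"
    using assms by (auto simp: torus_diff_lift_def bij_imp_bij_inv inv_inv_eq)
  have ex: "\<exists>A. linear A \<and> (\<forall>k\<in>intvecs. A k \<in> intvecs \<and> (\<forall>x. H (x + k) = H x + A k))"
    if "torus_diff_lift H" for H
  proof -
    define a where "a k = H k - H 0" for k
    have sh: "H (x + k) = H x + a k" if "k \<in> intvecs" for x k
      using torus_diff_lift_shift[OF \<open>torus_diff_lift H\<close> that, of x 0] by (simp add: a_def algebra_simps)
    have "a (k + l) = a k + a l" if "k \<in> intvecs" "l \<in> intvecs" for k l
      using sh[OF that(2), of k] by (simp add: a_def)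
    from linear_from_intvecs[of a, OF this] obtain A where A: "linear A" "\<forall>k\<in>intvecs. A k = a k" by blast
    moreover have "a k \<in> intvecs" if "k \<in> intvecs" for k
      using \<open>torus_diff_lift H\<close> that unfolding torus_diff_lift_def a_def by (metis add_0)
    ultimately show ?thesis using sh by (intro exI[of _ A]) auto
  qed
  obtain A where A: "linear A" "\<And>k. k \<in> intvecs \<Longrightarrow> A k \<in> intvecs"
    "\<And>x k. k \<in> intvecs \<Longrightarrow> H (x + k) = H x + A k" using ex[OF assms] by blast
  obtain B where B: "linear B" "\<And>k. k \<in> intvecs \<Longrightarrow> B k \<in> intvecs"
    "\<And>x k. k \<in> intvecs \<Longrightarrow> inv H (x + k) = inv H x + B k" using ex[OF inv] by blast
  have BA: "B (A x) = x" for x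
  proof -
    have "(B \<circ> A) x = id x"
    proof (rule linear_eq_on_intvecs[of "B \<circ> A" id])
      fix k :: R2 assume k: "k \<in> intvecs"
      have "inv H (H (0 + k)) = inv H (H 0 + A k)" by (simp only: A(3)[OF k])
      then show "(B \<circ> A) k = id k"
        using B(3)[OF A(2)[OF k]] by (simp add: bij_is_inj[OF bij])
    qed (auto simp: linear_compose A B linear_id)
    then show ?thesis by simp
  qed
  have AB: "A (B x) = x" for x
  proof -
    have "(A \<circ> B) x = id x"
    proof (rule linear_eq_on_intvecs[of "A \<circ> B" id])
      fix k :: R2 assume k: "k \<in> intvecs"
      have "H (inv H (0 + k)) = H (inv H 0 + B k)" by (simp only: B(3)[OF k])
      then show "(A \<circ> B) k = id k"
        using A(3)[OF B(2)[OF k]] by (simp add: bij_is_surj[OF bij] surj_f_inv_f)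
    qed (auto simp: linear_compose A B linear_id)
    then show ?thesis by simp
  qed
  have "bounded ((\<lambda>x. H x - A x) ` unit_square)"
    by (intro compact_imp_bounded compact_continuous_image continuous_on_diff compact_unit_square
      smooth_continuous_on[OF sm(1)] linear_continuous_on) (simp add: A(1) linear_linear)
  then obtain C where C: "\<And>x. x \<in> unit_square \<Longrightarrow> norm (H x - A x) \<le> C"
    by (auto simp: bounded_iff)
  have "norm (H x - A x) \<le> C" for x
  proof -
    obtain k where k: "k \<in> intvecs" "x - k \<in> unit_square" using unit_square_cover by blast
    have "H x - A x = H (x - k) - A (x - k)"
      using A(3)[OF k(1), of "x - k"] by (simp add: linear_diff[OF A(1)])
    with C[OF k(2)] show ?thesis by simp
  qed
  with A B AB BA show ?thesis by (intro that[of A B C]) auto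
qed

section \<open>Shears\<close>

definition shear :: "real \<Rightarrow> (R2 \<Rightarrow> real) \<Rightarrow> R2 \<Rightarrow> R2 \<Rightarrow> R2" where
  "shear c l v x = x + (c * sin (2 * pi * l x)) *\<^sub>R v"

text \<open>Shearing back with the opposite amplitude therefore meets the same sine, which inverts
  the shear explicitly.\<close>

lemma linear_functional_shear: "linear l \<Longrightarrow> l v = 0 \<Longrightarrow> l (shear c l v x) = l x"
  by (simp add: shear_def linear_add linear_cmul)

lemma shear_inverse: "linear l \<Longrightarrow> l v = 0 \<Longrightarrow> shear c l v (shear (- c) l v x) = x"
  using linear_functional_shear[of l v "- c" x] by (simp add: shear_def[of c]) (simp add: shear_def)

lemma bij_shear: "linear l \<Longrightarrow> l v = 0 \<Longrightarrow> bij (shear c l v)"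
  using shear_inverse[of l v c] shear_inverse[of l v "- c"]
  by (intro o_bij[of "shear (- c) l v"]) auto

lemma inv_shear: "linear l \<Longrightarrow> l v = 0 \<Longrightarrow> inv (shear c l v) = shear (- c) l v"
  using shear_inverse[of l v c] shear_inverse[of l v "- c"]
  by (intro inv_unique_comp) auto

lemma smooth_shear:
  assumes "linear l"
  shows "smooth (shear c l v)"
proof -
  have "linear (\<lambda>x. 2 * pi * l x)"
    using assms by (simp add: linear_iff algebra_simps)
  from smooth_add[OF smooth_id smooth_sin[OF this, of 0 "c *\<^sub>R v"]]
  show ?thesis by (simp add: shear_def[abs_def] mult.commute)
qed

lemma shear_has_derivative:
  assumes "linear l"
  shows "(shear c l v has_derivative (\<lambda>h. h + (c * 2 * pi * cos (2 * pi * l x) * l h) *\<^sub>R v)) (at x within S)"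
proof -
  have "(l has_derivative l) (at x within S)" by (rule linear_imp_has_derivative[OF assms])
  then show ?thesis unfolding shear_def[abs_def]
    by (auto intro!: derivative_eq_intros simp: algebra_simps)
qed

text \<open>A rank-one perturbation of the identity has determinant 1 plus its trace, and the trace
  \<open>a * l v\<close> vanishes.\<close>

lemma det_rank_one_perturbation:
  assumes "linear (l :: R2 \<Rightarrow> real)" "l v = 0"
  shows "det (matrix (\<lambda>h. h + (a * l h) *\<^sub>R v)) = 1"
proof -
  have v: "v = v $ 1 *\<^sub>R axis 1 1 + v $ 2 *\<^sub>R axis 2 1"
    by (simp add: vec_eq_iff forall_2 axis_def)
  have "l v = v $ 1 * l (axis 1 1) + v $ 2 * l (axis 2 1)"
    by (subst v) (simp add: linear_add[OF assms(1)] linear_cmul[OF assms(1)])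
  then have "v $ 1 * l (axis 1 1) + v $ 2 * l (axis 2 1) = 0" using assms(2) by simp
  moreover have "det (matrix (\<lambda>h. h + (a * l h) *\<^sub>R v))
      = 1 + a * (v $ 1 * l (axis 1 1) + v $ 2 * l (axis 2 1))"
    by (simp add: det_2 matrix_def axis_def[where k=1] algebra_simps) (simp add: axis_def)
  ultimately show ?thesis by simp
qed

lemma area_pres_shear:
  assumes l: "linear l" "l v = 0"
  shows "area_pres (shear c l v)"
proof -
  let ?s = "shear c l v" and ?s' = "shear (- c) l v"
  have meas: "?s \<in> borel_measurable borel"
    by (intro borel_measurable_continuous_onI smooth_continuous_on smooth_shear l)
  have "lborel = distr lborel lborel ?s"
  proof (rule lborel_eqI)
    fix a b :: R2 assume ab: "\<And>i. i \<in> Basis \<Longrightarrow> a \<bullet> i \<le> b \<bullet> i"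
    \<comment> \<open>The change of variables theorem speaks of images, so the preimage of the box
      becomes an image under the inverse shear, whose Jacobian is 1.\<close>
    have vim: "?s -` box a b = ?s' ` box a b"
      using shear_inverse[OF l, of c] shear_inverse[OF l, of "- c"]
      by (auto simp: image_iff) (metis add.inverse_inverse)
    have inj: "inj_on ?s' (box a b)"
      using bij_shear[OF l] bij_is_inj inj_on_subset by blast
    let ?m = "measure lebesgue (box a b)"
    have "((\<lambda>x. 1 :: real) has_integral ?m) (box a b)"
      using has_integral_measure_lborel[of "box a b"] by (simp add: emeasure_lborel_box_eq)
    then have "((\<lambda>x. \<bar>det (matrix (\<lambda>h. h + (- c * 2 * pi * cos (2 * pi * l x) * l h) *\<^sub>R v))\<bar>) has_integral ?m) (box a b)"
      by (simp only: det_rank_one_perturbation[OF l] abs_one)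
    then have img: "?s' ` box a b \<in> lmeasurable \<and> measure lebesgue (?s' ` box a b) = ?m"
      by (subst has_measure_differentiable_image[OF _ shear_has_derivative[OF l(1)] inj]) auto
    have sets: "?s -` box a b \<in> sets borel"
      using measurable_sets[OF meas, of "box a b"] by simp
    have "emeasure (distr lborel lborel ?s) (box a b) = emeasure lborel (?s -` box a b)"
      using meas by (subst emeasure_distr) auto
    also have "\<dots> = emeasure lebesgue (?s -` box a b)"
      using sets by (simp add: emeasure_completion)
    also have "\<dots> = emeasure lebesgue (box a b)"
      using img unfolding vim by (metis emeasure_eq_measure2 lmeasurable_box)
    also have "\<dots> = ennreal (\<Prod>i\<in>Basis. (b - a) \<bullet> i)"
      using ab by (simp add: emeasure_lborel_box)
    finally show "emeasure (distr lborel lborel ?s) (box a b) = ennreal (\<Prod>i\<in>Basis. (b - a) \<bullet> i)" .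
  qed simp
  then show ?thesis using meas by (simp add: area_pres_def)
qed

lemma area_pres_comp: "area_pres F \<Longrightarrow> area_pres G \<Longrightarrow> area_pres (F \<circ> G)"
  unfolding area_pres_def using distr_distr[of F lborel lborel G lborel] by (auto simp: measurable_comp)

section \<open>Zonotopes of displacements\<close>

fun zonotope :: "real \<Rightarrow> R2 list \<Rightarrow> R2 set" where
  "zonotope c [] = {0}"
| "zonotope c (v # vs) = {t *\<^sub>R v + z | t z. \<bar>t\<bar> \<le> c \<and> z \<in> zonotope c vs}"

text \<open>These are the displacements that successive shears can produce without interfering with
  one another.\<close>

fun int_combinations :: "nat \<Rightarrow> R2 list \<Rightarrow> R2 set" where
  "int_combinations M [] = {0}"
| "int_combinations M (v # vs) = {of_int j *\<^sub>R v + z | j z. \<bar>j\<bar> \<le> int M \<and> z \<in> int_combinations M vs}"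

lemma zonotope_diff:
  "z \<in> zonotope c vs \<Longrightarrow> z' \<in> zonotope c' vs \<Longrightarrow> z - z' \<in> zonotope (c + c') vs"
proof (induction vs arbitrary: z z')
  case (Cons v vs)
  then obtain t y t' y' where *: "z = t *\<^sub>R v + y" "\<bar>t\<bar> \<le> c" "y \<in> zonotope c vs"
    "z' = t' *\<^sub>R v + y'" "\<bar>t'\<bar> \<le> c'" "y' \<in> zonotope c' vs" by auto
  have "z - z' = (t - t') *\<^sub>R v + (y - y')" using * by (simp add: algebra_simps)
  moreover have "\<bar>t - t'\<bar> \<le> c + c'" using * by linarith
  ultimately show ?case using Cons.IH[OF *(3,6)] unfolding zonotope.simps by blast
qed simp

lemma zonotope_linear_image:
  "linear A \<Longrightarrow> z \<in> zonotope c vs \<Longrightarrow> A z \<in> zonotope c (map A vs)"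
proof (induction vs arbitrary: z)
  case (Cons v vs)
  then obtain t y where "z = t *\<^sub>R v + y" "\<bar>t\<bar> \<le> c" "y \<in> zonotope c vs" by auto
  with Cons show ?case by (auto simp: linear_add linear_cmul)
qed (simp add: linear_0)

lemma zonotope_scale:
  "r \<ge> 0 \<Longrightarrow> z \<in> zonotope c vs \<Longrightarrow> r *\<^sub>R z \<in> zonotope (r * c) vs"
proof (induction vs arbitrary: z)
  case (Cons v vs)
  then obtain t y where *: "z = t *\<^sub>R v + y" "\<bar>t\<bar> \<le> c" "y \<in> zonotope c vs" by auto
  have "r *\<^sub>R z = (r * t) *\<^sub>R v + r *\<^sub>R y" using * by (simp add: algebra_simps)
  moreover have "\<bar>r * t\<bar> \<le> r * c" using * Cons(2) by (simp add: abs_mult mult_left_mono)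
  ultimately show ?case using Cons * by auto
qed simp

lemma zonotope_eq_scale:
  assumes "r > 0"
  shows "zonotope r vs = (\<lambda>z. r *\<^sub>R z) ` zonotope 1 vs"
proof
  show "zonotope r vs \<subseteq> (\<lambda>z. r *\<^sub>R z) ` zonotope 1 vs"
  proof
    fix z assume z: "z \<in> zonotope r vs"
    have "z = r *\<^sub>R (inverse r *\<^sub>R z)" using assms by simp
    moreover have "inverse r *\<^sub>R z \<in> zonotope 1 vs"
      using zonotope_scale[of "inverse r" z r vs] z assms by simp
    ultimately show "z \<in> (\<lambda>z. r *\<^sub>R z) ` zonotope 1 vs" by (rule image_eqI)
  qed
qed (use assms zonotope_scale[of r _ 1 vs] in auto)

lemma int_combinations_linear_image:
  "linear A \<Longrightarrow> z \<in> int_combinations M (map A vs) \<Longrightarrow> \<exists>y\<in>int_combinations M vs. z = A y"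
proof (induction vs arbitrary: z)
  case (Cons v vs)
  then obtain j y where *: "z = of_int j *\<^sub>R A v + y" "\<bar>j\<bar> \<le> int M" "y \<in> int_combinations M (map A vs)" by auto
  then obtain y' where "y' \<in> int_combinations M vs" "y = A y'" using Cons by blast
  with * show ?case
    using Cons(2) by (intro bexI[of _ "of_int j *\<^sub>R v + y'"]) (auto simp: linear_add linear_cmul)
qed (simp add: linear_0)

text \<open>Each coefficient is rounded down. The error does not grow with \<open>M\<close>, so it
  is negligible relative to the zonotope.\<close>

lemma zonotope_near_int_combinations:
  "z \<in> zonotope (real M) vs \<Longrightarrow>
    \<exists>y\<in>int_combinations M vs. norm (z - y) \<le> (\<Sum>v\<leftarrow>vs. norm v)"
proof (induction vs arbitrary: z)
  case (Cons v vs)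
  then obtain t y where *: "z = t *\<^sub>R v + y" "\<bar>t\<bar> \<le> real M" "y \<in> zonotope (real M) vs" by auto
  then obtain y' where y': "y' \<in> int_combinations M vs" "norm (y - y') \<le> (\<Sum>v\<leftarrow>vs. norm v)"
    using Cons by blast
  have "norm ((t - of_int \<lfloor>t\<rfloor>) *\<^sub>R v) \<le> norm v"
    using mult_right_mono[of "\<bar>t - of_int \<lfloor>t\<rfloor>\<bar>" 1 "norm v"] by simp linarith
  moreover have "z - (of_int \<lfloor>t\<rfloor> *\<^sub>R v + y') = (t - of_int \<lfloor>t\<rfloor>) *\<^sub>R v + (y - y')"
    using * by (simp add: algebra_simps)
  ultimately have "norm (z - (of_int \<lfloor>t\<rfloor> *\<^sub>R v + y')) \<le> norm v + (\<Sum>v\<leftarrow>vs. norm v)"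
    using y'(2) by (metis add_mono norm_triangle_le)
  \<comment> \<open>\<open>M\<close> is an integer, so rounding down cannot fall below
    \<open>- M\<close>.\<close>
  moreover have "\<bar>\<lfloor>t\<rfloor>\<bar> \<le> int M" using *(2) by linarith
  ultimately show ?case using y'(1) by (intro bexI[of _ "of_int \<lfloor>t\<rfloor> *\<^sub>R v + y'"]) auto
qed simp

section \<open>Torus maps commuting with translations of denominator q\<close>

lemma lift_uniformly_continuous:
  assumes "continuous_on UNIV (F :: R2 \<Rightarrow> R2)" "\<And>x k. k \<in> intvecs \<Longrightarrow> F (x + k) = F x + k"
  shows "uniformly_continuous_on UNIV F"
  unfolding uniformly_continuous_on_def
proof (intro allI impI)
  fix e :: real assume "e > 0"
  \<comment> \<open>The margin of width 1 keeps neighbours of a point of the square inside the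
    compact set; this is the cap on the final modulus.\<close>
  define S where "S = (\<Union>x\<in>unit_square. cball x 1)"
  have "S = {x + y | x y. x \<in> unit_square \<and> y \<in> cball 0 1}"
    by (auto simp: S_def dist_norm) (metis add_diff_cancel_left' diff_add_cancel add.commute norm_minus_commute)
  then have "compact S" using compact_sums[OF compact_unit_square compact_cball[of "0::R2" 1]] by simp
  moreover have "continuous_on S F" using assms(1) continuous_on_subset by blast
  ultimately have "uniformly_continuous_on S F" by (rule compact_uniformly_continuous[rotated])
  with \<open>e > 0\<close> obtain d where d: "d > 0" "\<And>x y. x \<in> S \<Longrightarrow> y \<in> S \<Longrightarrow> dist y x < d \<Longrightarrow> dist (F y) (F x) < e"
    unfolding uniformly_continuous_on_def by metis
  have "dist (F y) (F x) < e" if "dist y x < min d 1" for x y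
  proof -
    obtain k where k: "k \<in> intvecs" "x - k \<in> unit_square" using unit_square_cover by blast
    have "x - k \<in> S" "y - k \<in> S" using k(2) that by (auto simp: S_def dist_norm norm_minus_commute intro!: bexI[of _ "x - k"])
    moreover have "dist (y - k) (x - k) < d" using that by (simp add: dist_norm)
    ultimately have "dist (F (y - k)) (F (x - k)) < e" using d(2) by blast
    moreover have "F x = F (x - k) + k" "F y = F (y - k) + k"
      using assms(2)[OF k(1), of "x - k"] assms(2)[OF k(1), of "y - k"] by simp_all
    ultimately show ?thesis by simp
  qed
  then show "\<exists>d>0. \<forall>x\<in>UNIV. \<forall>x'\<in>UNIV. dist x' x < d \<longrightarrow> dist (F x') (F x) < e"
    using d(1) by (intro exI[of _ "min d 1"]) auto
qed

text \<open>The admissible \<open>k\<close> form the lattice (1/q)Z^2. It contains the integer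
  vectors, so \<open>h\<close> lifts a torus map homotopic to the identity, and also every rotation
  vector of denominator q.\<close>

definition lattice_diff :: "nat \<Rightarrow> (R2 \<Rightarrow> R2) \<Rightarrow> bool" where
  "lattice_diff q h \<longleftrightarrow> bij h \<and> smooth h \<and> smooth (inv h) \<and> area_pres h \<and>
     (\<forall>x k. real q *\<^sub>R k \<in> intvecs \<longrightarrow> h (x + k) = h x + k)"

lemma lattice_diff_comp:
  assumes "lattice_diff q f" "lattice_diff q g"
  shows "lattice_diff q (f \<circ> g)"
  using assms unfolding lattice_diff_def
  by (auto simp: bij_comp smooth_comp area_pres_comp o_inv_distrib)

lemma lattice_diff_shear:
  assumes l: "linear l" "l v = 0" "\<And>k. real q *\<^sub>R k \<in> intvecs \<Longrightarrow> l k \<in> \<int>"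
  shows "lattice_diff q (shear c l v)"
proof -
  have "sin (2 * pi * l (x + k)) = sin (2 * pi * l x)" if k: "real q *\<^sub>R k \<in> intvecs" for x k
  proof -
    obtain n where "l k = of_int n" using l(3)[OF k] by (auto elim: Ints_cases)
    then have "2 * pi * l (x + k) = 2 * pi * l x + 2 * pi * of_int n"
      by (simp add: linear_add[OF l(1)] algebra_simps)
    then show ?thesis by (simp add: sin_add)
  qed
  then have "shear c l v (x + k) = shear c l v x + k" if "real q *\<^sub>R k \<in> intvecs" for x k
    using that by (simp add: shear_def)
  then show ?thesis
    unfolding lattice_diff_def
    using bij_shear[OF l(1,2)] smooth_shear[OF l(1)] inv_shear[OF l(1,2)] area_pres_shear[OF l(1,2)]
    by metis
qed

lemma intvecs_lattice: "k \<in> intvecs \<Longrightarrow> real q *\<^sub>R k \<in> intvecs"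
  using intvecs_scale[of k "int q"] by simp

lemma lattice_diff_uniformly_continuous:
  "lattice_diff q h \<Longrightarrow> uniformly_continuous_on UNIV h"
  by (rule lift_uniformly_continuous)
     (auto simp: lattice_diff_def smooth_continuous_on intvecs_lattice)

text \<open>Along \<open>u\<close> the phase completes a full period within distance
  \<open>norm u / real N\<close>.\<close>

lemma sin_attained_nearby:
  assumes "linear (l :: R2 \<Rightarrow> real)" "l u = 1" "N > 0" "\<bar>a\<bar> \<le> 1"
  shows "\<exists>y'. norm (y' - y) \<le> norm u / real N \<and> sin (2 * pi * (real N * l y')) = a"
proof -
  \<comment> \<open>\<open>p\<close> is the phase, in periods, by which \<open>y\<close> is ahead of
    a point with the wanted sine; \<open>\<tau>\<close> is the wait until the next such
    point.\<close>
  define p where "p = real N * l y - arcsin a / (2 * pi)"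
  define \<tau> where "\<tau> = (of_int \<lceil>p\<rceil> - p) / real N"
  have \<tau>: "0 \<le> \<tau>" "\<tau> \<le> 1 / real N"
    unfolding \<tau>_def using assms(3) by (auto intro!: divide_right_mono) linarith
  have "real N * (l y + \<tau>) = arcsin a / (2 * pi) + of_int \<lceil>p\<rceil>"
    using assms(3) by (simp add: \<tau>_def p_def field_simps)
  then have "2 * pi * (real N * (l y + \<tau>)) = arcsin a + 2 * pi * of_int \<lceil>p\<rceil>"
    by (simp add: field_simps)
  then have "sin (2 * pi * (real N * l (y + \<tau> *\<^sub>R u))) = a"
    using assms by (simp add: linear_add linear_cmul sin_add)
  moreover have "norm (y + \<tau> *\<^sub>R u - y) \<le> norm u / real N"
    using \<tau> mult_right_mono[OF \<tau>(2), of "norm u"] by simp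
  ultimately show ?thesis by blast
qed

text \<open>An odd multiple of a half-integer is again a half-integer, so raising the frequency by
  an odd factor keeps \<open>\<gamma>\<close> a half period.\<close>

lemma sin_half_period:
  assumes "b - 1/2 \<in> \<int>"
  shows "sin (2 * pi * (real (2 * m + 1) * (a + b))) = - sin (2 * pi * (real (2 * m + 1) * a))"
proof -
  obtain n where n: "b = of_int n + 1/2" using assms by (auto elim!: Ints_cases simp: algebra_simps)
  define k where "k = (2 * int m + 1) * n + int m"
  have "2 * pi * (real (2 * m + 1) * (a + b)) = 2 * pi * (real (2 * m + 1) * a) + pi + 2 * pi * of_int k"
    by (simp add: n k_def field_simps)
  then show ?thesis by (simp add: sin_add)
qed

text \<open>Translation by \<open>\<gamma>\<close> reverses the sign of each shear. A shear of very high frequency is added on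
  the inside, so that it attains all of its values without disturbing the displacement produced by the
  previous ones; restricting to values which move points by lattice vectors makes the displacements add up.\<close>

lemma exists_lattice_diff_with_displacements:
  fixes ps :: "(R2 \<times> (R2 \<Rightarrow> real)) list"
  assumes "\<And>v l. (v, l) \<in> set ps \<Longrightarrow> v \<in> intvecs \<and> linear l \<and> l v = 0 \<and> l \<gamma> - 1/2 \<in> \<int> \<and>
      (\<forall>k. real q *\<^sub>R k \<in> intvecs \<longrightarrow> l k \<in> \<int>)"
    and "M > 0" "e > 0"
  shows "\<exists>h. lattice_diff q h \<and> (\<forall>x. h x - x \<in> zonotope (real M / 2) (map fst ps)) \<and>
     (\<forall>z\<in>int_combinations M (map fst ps). \<exists>y. norm (h (y + \<gamma>) - h y - \<gamma> - z) < e)"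
  using assms(1,3)
proof (induction ps arbitrary: e)
  case Nil
  have "lattice_diff q (\<lambda>x. x)"
    using lattice_diff_shear[of "\<lambda>x. 0" 0 q 0] by (simp add: linear_zero shear_def[abs_def])
  then show ?case using Nil by (intro exI[of _ "\<lambda>x. x"]) auto
next
  case (Cons p ps)
  obtain v l where p: "p = (v, l)" by fastforce
  have l: "v \<in> intvecs" "linear l" "l v = 0" "l \<gamma> - 1/2 \<in> \<int>" "\<And>k. real q *\<^sub>R k \<in> intvecs \<Longrightarrow> l k \<in> \<int>"
    using Cons.prems(1)[of v l] by (auto simp: p)
  have ps: "\<And>v l. (v, l) \<in> set ps \<Longrightarrow> v \<in> intvecs \<and> linear l \<and> l v = 0 \<and> l \<gamma> - 1/2 \<in> \<int> \<and>
      (\<forall>k. real q *\<^sub>R k \<in> intvecs \<longrightarrow> l k \<in> \<int>)" using Cons.prems(1) by (meson list.set_intros(2))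
  obtain h where h: "lattice_diff q h" "\<And>x. h x - x \<in> zonotope (real M / 2) (map fst ps)"
    "\<And>z. z \<in> int_combinations M (map fst ps) \<Longrightarrow> \<exists>y. norm (h (y + \<gamma>) - h y - \<gamma> - z) < e / 2"
    using Cons.IH[OF ps, of "e/2"] Cons.prems(2) by fastforce
  \<comment> \<open>Replacing \<open>y\<close> by a nearby \<open>y'\<close> disturbs
    \<open>h\<close> at two points, each costing e/4; the inductive error takes the remaining
    e/2.\<close>
  have "e / 4 > 0" using Cons.prems(2) by simp
  then obtain d where d: "d > 0" "\<And>x y. dist y x < d \<Longrightarrow> dist (h y) (h x) < e / 4"
    using lattice_diff_uniformly_continuous[OF h(1)] unfolding uniformly_continuous_on_def
    by (metis UNIV_I)
  have "l \<gamma> \<noteq> 0"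
  proof
    assume "l \<gamma> = 0"
    then have "(1/2 :: real) \<in> \<int>" using Ints_minus[OF l(4)] by simp
    then obtain n where "(1/2 :: real) = of_int n" by (auto elim: Ints_cases)
    then have "real_of_int (2 * n) = of_int 1" by simp
    then have "2 * n = 1" by (simp only: of_int_eq_iff)
    then show False by presburger
  qed
  \<comment> \<open>A direction along which \<open>l\<close> advances at unit speed;
    \<open>\<gamma>\<close> can be rescaled to it because \<open>l \<gamma>\<close> is a
    half-integer, hence nonzero.\<close>
  define u where "u = inverse (l \<gamma>) *\<^sub>R \<gamma>"
  have lu: "l u = 1" using \<open>l \<gamma> \<noteq> 0\<close> by (simp add: u_def linear_cmul[OF l(2)])
  \<comment> \<open>One period of the new shear along \<open>u\<close> has to be shorter than d, and
    the frequency has to be odd.\<close>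
  obtain m :: nat where m: "norm u / d < real m" using reals_Archimedean2 by blast
  define N where "N = 2 * m + 1"
  have "N > 0" by (simp add: N_def)
  have "norm u / d < real N" using m by (simp add: N_def)
  then have N: "norm u / real N < d" using d(1) \<open>N > 0\<close> by (simp add: field_simps)
  define l' where "l' x = real N * l x" for x
  \<comment> \<open>Opposite sines at \<open>x\<close> and \<open>x + \<gamma>\<close> double the
    effect, so amplitude M/2 yields coefficients up to M.\<close>
  define s where "s = shear (real M / 2) l' v"
  have l': "linear l'" "l' v = 0" "\<And>k. real q *\<^sub>R k \<in> intvecs \<Longrightarrow> l' k \<in> \<int>"
    using l(2,3,5) by (auto simp: l'_def linear_iff algebra_simps)
  have s: "lattice_diff q s" unfolding s_def by (rule lattice_diff_shear[OF l'])
  have h': "lattice_diff q (h \<circ> s)" by (rule lattice_diff_comp[OF h(1) s])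
  have U: "(h \<circ> s) x - x \<in> zonotope (real M / 2) (map fst (p # ps))" for x
  proof -
    have "(h \<circ> s) x - x = (real M / 2 * sin (2 * pi * l' x)) *\<^sub>R v + (h (s x) - s x)"
      by (simp add: s_def shear_def)
    moreover have "\<bar>real M / 2 * sin (2 * pi * l' x)\<bar> \<le> real M / 2"
      using mult_left_mono[OF abs_sin_le_one, of "real M / 2"] by (simp add: abs_mult)
    ultimately show ?thesis
      using h(2)[of "s x"] unfolding p list.map fst_conv zonotope.simps by blast
  qed
  have L: "\<exists>x. norm ((h \<circ> s) (x + \<gamma>) - (h \<circ> s) x - \<gamma> - z) < e"
    if z: "z \<in> int_combinations M (map fst (p # ps))" for z
  proof -
    obtain j z' where z': "z = of_int j *\<^sub>R v + z'" "\<bar>j\<bar> \<le> int M" "z' \<in> int_combinations M (map fst ps)"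
      using z by (auto simp: p)
    obtain y where y: "norm (h (y + \<gamma>) - h y - \<gamma> - z') < e / 2" using h(3)[OF z'(3)] by blast
    \<comment> \<open>With this value of the sine, \<open>s\<close> moves \<open>x\<close> by
      \<open>-j/2\<close> times \<open>v\<close> and \<open>x + \<gamma>\<close> by
      \<open>+j/2\<close> times \<open>v\<close>: net displacement \<open>j\<close> times
      \<open>v\<close>.\<close>
    have "\<bar>- real_of_int j / real M\<bar> \<le> 1" using z'(2) assms(2) by simp
    from sin_attained_nearby[OF l(2) lu \<open>N > 0\<close> this, of y]
    obtain y' where y': "norm (y' - y) \<le> norm u / real N" "sin (2 * pi * l' y') = - real_of_int j / real M"
      by (auto simp: l'_def)
    define x where "x = shear (- (real M / 2)) l' v y'"
    have sx: "s x = y'" unfolding s_def x_def by (rule shear_inverse[OF l'(1,2)])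
    have l'x: "l' x = l' y'" unfolding x_def by (rule linear_functional_shear[OF l'(1,2)])
    have xy: "x = y' + (of_int j / 2) *\<^sub>R v"
      using y'(2) assms(2) by (simp add: x_def shear_def)
    have "sin (2 * pi * l' (x + \<gamma>)) = - sin (2 * pi * l' x)"
      using sin_half_period[OF l(4), of m "l x"] by (simp add: l'_def N_def linear_add[OF l(2)])
    then have "s (x + \<gamma>) = x + \<gamma> + (of_int j / 2) *\<^sub>R v"
      using y'(2) assms(2) by (simp add: s_def shear_def l'x)
    also have "\<dots> = y' + \<gamma> + of_int j *\<^sub>R v"
      unfolding xy by (simp add: algebra_simps scaleR_add_left[symmetric])
    \<comment> \<open>The shift is an integer vector, so it passes through \<open>h\<close>
      unchanged and is added to the displacement produced by \<open>h\<close>.\<close>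
    finally have "h (s (x + \<gamma>)) = h (y' + \<gamma>) + of_int j *\<^sub>R v"
      using h(1) intvecs_lattice[OF intvecs_scale[OF l(1)]] by (simp add: lattice_diff_def)
    then have eq: "(h \<circ> s) (x + \<gamma>) - (h \<circ> s) x - \<gamma> - z = (h (y + \<gamma>) - h y - \<gamma> - z')
        + (h (y' + \<gamma>) - h (y + \<gamma>)) + (h y - h y')"
      by (simp add: sx z'(1))
    have "dist (y' + \<gamma>) (y + \<gamma>) < d" "dist y y' < d"
      using y'(1) N by (simp_all add: dist_norm norm_minus_commute)
    then have "norm (h (y' + \<gamma>) - h (y + \<gamma>)) < e / 4" "norm (h y - h y') < e / 4"
      using d(2) by (simp_all add: dist_norm)
    then have "norm ((h \<circ> s) (x + \<gamma>) - (h \<circ> s) x - \<gamma> - z) < e"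
      unfolding eq using y norm_triangle_ineq[of "h (y + \<gamma>) - h y - \<gamma> - z'" "h (y' + \<gamma>) - h (y + \<gamma>)"]
        norm_triangle_ineq[of "(h (y + \<gamma>) - h y - \<gamma> - z') + (h (y' + \<gamma>) - h (y + \<gamma>))" "h y - h y'"]
      by linarith
    then show ?thesis by blast
  qed
  show ?case using h' U L by blast
qed

section \<open>Approximation of planar symmetric convex bodies by zonotopes\<close>

definition hausdorff_near :: "real \<Rightarrow> R2 set \<Rightarrow> R2 set \<Rightarrow> bool" where
  "hausdorff_near e S T \<longleftrightarrow> (\<forall>x\<in>S. \<exists>y\<in>T. dist x y < e) \<and> (\<forall>y\<in>T. \<exists>x\<in>S. dist x y < e)"

lemma hausdorff_nearI:
  assumes "\<And>x. x \<in> S \<Longrightarrow> \<exists>y\<in>T. dist x y \<le> d" "\<And>y. y \<in> T \<Longrightarrow> \<exists>x\<in>S. dist y x \<le> d" "d < e"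
  shows "hausdorff_near e S T"
  unfolding hausdorff_near_def
proof (intro conjI ballI)
  fix x assume "x \<in> S"
  then show "\<exists>y\<in>T. dist x y < e" using assms(1,3) le_less_trans by blast
next
  fix y assume "y \<in> T"
  then obtain x where "x \<in> S" "dist y x \<le> d" using assms(2) by blast
  then show "\<exists>x\<in>S. dist x y < e" using assms(3) by (intro bexI[of _ x]) (simp_all add: dist_commute)
qed

lemma hausdorff_near_trans:
  assumes "hausdorff_near d S T" "hausdorff_near e T U"
  shows "hausdorff_near (d + e) S U"
  unfolding hausdorff_near_def
proof (intro conjI ballI)
  fix x assume "x \<in> S"
  then obtain y z where "y \<in> T" "dist x y < d" "z \<in> U" "dist y z < e"
    using assms unfolding hausdorff_near_def by blast
  then show "\<exists>y\<in>U. dist x y < d + e" using dist_triangle[of x z y] by (intro bexI[of _ z]) auto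
next
  fix z assume "z \<in> U"
  then obtain y x where "y \<in> T" "dist y z < e" "x \<in> S" "dist x y < d"
    using assms unfolding hausdorff_near_def by blast
  then show "\<exists>y\<in>S. dist y z < d + e" using dist_triangle[of x z y] by (intro bexI[of _ x]) auto
qed

lemma hausdorff_near_sym: "hausdorff_near e S T \<Longrightarrow> hausdorff_near e T S"
  by (auto simp: hausdorff_near_def dist_commute)

lemma hausdorff_near_mono: "hausdorff_near d S T \<Longrightarrow> d \<le> e \<Longrightarrow> hausdorff_near e S T"
  unfolding hausdorff_near_def by (meson less_le_trans)

lemma hausdorff_near_affine:
  assumes "hausdorff_near e S T" "r > 0"
  shows "hausdorff_near (r * e) ((\<lambda>x. r *\<^sub>R x + c) ` S) ((\<lambda>x. r *\<^sub>R x + c) ` T)"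
proof -
  have "dist (r *\<^sub>R x + c) (r *\<^sub>R y + c) = r * dist x y" for x y
    using assms(2) by (simp add: dist_norm scaleR_diff_right[symmetric])
  then show ?thesis using assms unfolding hausdorff_near_def by fastforce
qed

lemma zonotope_Cons_sums:
  "zonotope c (v # vs) = {x + y | x y. x \<in> (\<lambda>t. t *\<^sub>R v) ` {-c..c} \<and> y \<in> zonotope c vs}"
  by (fastforce simp: abs_le_iff minus_le_iff image_iff Bex_def)

lemma convex_zonotope: "convex (zonotope c vs)"
proof (induction vs)
  case (Cons v vs)
  have "convex ((\<lambda>t. t *\<^sub>R v) ` {-c..c})"
    by (intro convex_linear_image) (auto simp: linear_iff algebra_simps)
  from convex_sums[OF this Cons] show ?case
    unfolding zonotope_Cons_sums by (rule back_subst[of convex]) auto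
qed simp

lemma compact_zonotope: "compact (zonotope c vs)"
proof (induction vs)
  case (Cons v vs)
  have "compact ((\<lambda>t. t *\<^sub>R v) ` {-c..c})"
    by (intro compact_continuous_image continuous_intros) auto
  then show ?case unfolding zonotope_Cons_sums using Cons by (rule compact_sums)
qed simp

lemma zero_in_zonotope: "c \<ge> 0 \<Longrightarrow> 0 \<in> zonotope c vs"
proof (induction vs)
  case (Cons v vs)
  then show ?case by (auto intro!: exI[of _ 0])
qed simp

text \<open>With \<open>inner_zonotope_attained\<close> this computes the support function of the
  zonotope: the best coefficient of \<open>v\<close> is the sign of
  \<open>u \<bullet> v\<close>.\<close>

lemma inner_zonotope_le: "z \<in> zonotope 1 vs \<Longrightarrow> u \<bullet> z \<le> (\<Sum>v\<leftarrow>vs. \<bar>u \<bullet> v\<bar>)"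
proof (induction vs arbitrary: z)
  case (Cons v vs)
  then obtain t y where *: "z = t *\<^sub>R v + y" "\<bar>t\<bar> \<le> 1" "y \<in> zonotope 1 vs" by auto
  have "t * (u \<bullet> v) \<le> \<bar>u \<bullet> v\<bar>"
    using mult_right_mono[OF *(2), of "\<bar>u \<bullet> v\<bar>"] abs_ge_self[of "t * (u \<bullet> v)"] by (simp add: abs_mult)
  then show ?case using Cons.IH[OF *(3)] *(1) by (simp add: inner_add_right)
qed simp

lemma inner_zonotope_attained: "\<exists>z\<in>zonotope 1 vs. u \<bullet> z = (\<Sum>v\<leftarrow>vs. \<bar>u \<bullet> v\<bar>)"
proof (induction vs)
  case (Cons v vs)
  then obtain z where z: "z \<in> zonotope 1 vs" "u \<bullet> z = (\<Sum>v\<leftarrow>vs. \<bar>u \<bullet> v\<bar>)" by blast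
  have "sgn (u \<bullet> v) *\<^sub>R v + z \<in> zonotope 1 (v # vs)"
    using z(1) by (auto simp: abs_sgn_eq intro!: exI[of _ "sgn (u \<bullet> v)"] exI[of _ z])
  moreover have "u \<bullet> (sgn (u \<bullet> v) *\<^sub>R v + z) = (\<Sum>v\<leftarrow>v # vs. \<bar>u \<bullet> v\<bar>)"
    using z(2) by (simp add: inner_add_right abs_sgn mult.commute)
  ultimately show ?case by blast
qed simp

text \<open>In the direction from the closest point \<open>y\<close> to \<open>x\<close>, the set
  \<open>Z\<close> reaches no further than \<open>y\<close>. The distance is thus a gap between
  support values.\<close>

lemma support_dominated_imp_near:
  assumes "closed (Z :: R2 set)" "convex Z" "Z \<noteq> {}"
    and sup: "\<And>u x. norm u = 1 \<Longrightarrow> x \<in> K \<Longrightarrow> \<exists>z\<in>Z. u \<bullet> x \<le> u \<bullet> z + e"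
    and "x \<in> K" "e \<ge> 0"
  shows "\<exists>z\<in>Z. dist x z \<le> e"
proof -
  define y where "y = closest_point Z x"
  have y: "y \<in> Z" unfolding y_def by (rule closest_point_in_set[OF assms(1,3)])
  have "dist x y \<le> e"
  proof (cases "x = y")
    case False
    define u where "u = (1 / norm (x - y)) *\<^sub>R (x - y)"
    have "norm u = 1" using False by (simp add: u_def)
    then obtain z where z: "z \<in> Z" "u \<bullet> x \<le> u \<bullet> z + e" using sup assms(5) by blast
    have "(x - y) \<bullet> (z - y) \<le> 0" unfolding y_def by (rule closest_point_dot[OF assms(2,1) z(1)])
    then have "u \<bullet> (z - y) \<le> 0" by (simp add: u_def divide_nonpos_nonneg)
    moreover have "u \<bullet> (x - y) = norm (x - y)"
      using False by (simp add: u_def power2_norm_eq_inner[symmetric] power2_eq_square)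
    ultimately show ?thesis using z(2) by (simp add: inner_diff_right dist_norm)
  qed (use assms in simp)
  with y show ?thesis by blast
qed

section \<open>Support functions sampled at equally spaced directions\<close>

definition circle_vec :: "real \<Rightarrow> R2" where
  "circle_vec t = vector [cos t, sin t]"

lemma circle_vec_nth [simp]: "circle_vec t $ 1 = cos t" "circle_vec t $ 2 = sin t"
  by (simp_all add: circle_vec_def)

lemma inner_R2: "(x :: R2) \<bullet> y = x $ 1 * y $ 1 + x $ 2 * y $ 2"
  by (simp add: inner_vec_def sum_2)

lemma inner_circle_vec: "circle_vec s \<bullet> circle_vec t = cos (s - t)"
  by (simp add: inner_R2 cos_diff)

lemma norm_circle_vec: "norm (circle_vec t) = 1"
  by (simp add: norm_eq_1 inner_circle_vec)

lemma circle_vec_add_pi: "circle_vec (t + pi) = - circle_vec t"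
  by (simp add: vec_eq_iff forall_2)

text \<open>Pairing with a maximiser in direction t gives 2 cos(d) h(t) <= h(t - d) + h(t + d) for a
  support function h, the discrete form of h + h'' >= 0.\<close>

lemma circle_vec_sum: "circle_vec (t - d) + circle_vec (t + d) = (2 * cos d) *\<^sub>R circle_vec t"
  by (simp add: vec_eq_iff forall_2 cos_add cos_diff sin_add sin_diff)

text \<open>Symmetric bodies have even support functions, so a half circle of directions suffices;
  it is open at 0 and closed at pi to match sample indices from 1 to n.\<close>

lemma unit_vec_eq_circle_vec:
  assumes "norm (u :: R2) = 1"
  obtains s t where "s = 1 \<or> s = -1" "0 < t" "t \<le> pi" "u = s *\<^sub>R circle_vec t"
proof -
  have "(u $ 1)\<^sup>2 + (u $ 2)\<^sup>2 = 1"
    using assms by (simp add: norm_eq_1 inner_R2 power2_eq_square)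
  then obtain t where t: "0 \<le> t" "t < 2 * pi" "u $ 1 = cos t" "u $ 2 = sin t"
    using sincos_total_2pi by metis
  then have u: "u = circle_vec t" by (simp add: vec_eq_iff forall_2)
  consider "t = 0" | "0 < t" "t \<le> pi" | "pi < t" using t(1) by linarith
  then show ?thesis
  proof cases
    case 1
    then show ?thesis using that[of "-1" pi] u circle_vec_add_pi[of 0] by simp
  next
    case 2
    then show ?thesis using that[of 1 t] u by simp
  next
    case 3
    then show ?thesis using that[of "-1" "t - pi"] t u circle_vec_add_pi[of "t - pi"] by simp
  qed
qed

lemma norm_circle_vec_diff: "norm (circle_vec s - circle_vec t) \<le> 2 * \<bar>s - t\<bar>"
proof -
  have half: "\<bar>sin ((s - t) / 2)\<bar> \<le> \<bar>s - t\<bar> / 2" using abs_sin_x_le_abs_x[of "(s - t)/2"] by simp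
  have half': "\<bar>sin ((t - s) / 2)\<bar> \<le> \<bar>s - t\<bar> / 2" using abs_sin_x_le_abs_x[of "(t - s)/2"] by simp
  have "norm (circle_vec s - circle_vec t) \<le> \<bar>cos s - cos t\<bar> + \<bar>sin s - sin t\<bar>"
    using norm_le_l1_cart[of "circle_vec s - circle_vec t"] by (simp add: sum_2)
  also have "\<bar>cos s - cos t\<bar> \<le> \<bar>s - t\<bar>"
    using mult_mono[OF abs_sin_le_one[of "(s + t)/2"] half'] by (simp add: cos_diff_cos abs_mult)
  also have "\<bar>sin s - sin t\<bar> \<le> \<bar>s - t\<bar>"
    using mult_mono[OF half abs_cos_le_one[of "(s + t)/2"]] by (simp add: sin_diff_sin abs_mult)
  finally show ?thesis by simp
qed

lemma sum_shift_periodic: "f n = f 0 \<Longrightarrow> (\<Sum>i<n. f (Suc i)) = (\<Sum>i<n. f i :: real)"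
  using sum.lessThan_Suc_shift[of f n] sum.lessThan_Suc[of f n] by simp

text \<open>The function \<open>\<bar>sin\<bar>\<close> is the fundamental solution of the discrete analogue of \<open>h + h''\<close> on
  the projective line.\<close>

lemma abs_sin_second_difference:
  fixes d :: real and i j n :: nat
  assumes "n \<ge> 2" "d = pi / n" "i < n" "1 \<le> j" "j \<le> n"
  shows "\<bar>sin ((real i - j) * d)\<bar> + \<bar>sin ((real (i + 2) - j) * d)\<bar>
      - 2 * cos d * \<bar>sin ((real (i + 1) - j) * d)\<bar> = (if i + 1 = j then 2 * sin d else 0)"
proof -
  define a where "a = (real (i + 1) - j) * d"
  have d: "d > 0" "d \<le> pi" "real n * d = pi" using assms(1) by (auto simp: assms(2) field_simps)
  have eq: "(real i - j) * d = a - d" "(real (i + 2) - j) * d = a + d"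
    by (simp_all add: a_def algebra_simps)
  have add: "sin (a - d) + sin (a + d) = 2 * cos d * sin a" by (simp add: sin_add sin_diff)
  \<comment> \<open>Only i + 1 = j meets the kink of |sin| at 0. Otherwise the three angles share
    one of the intervals [0, pi] and [-pi, 0], on which |sin| is sin or -sin and the addition
    formula gives 0.\<close>
  consider "i + 1 = j" | "i + 1 > j" | "i + 1 < j" by linarith
  then have "\<bar>sin (a - d)\<bar> + \<bar>sin (a + d)\<bar> - 2 * cos d * \<bar>sin a\<bar> = (if i + 1 = j then 2 * sin d else 0)"
  proof cases
    case 1
    then have "a = 0" by (simp add: a_def)
    moreover have "sin d \<ge> 0" using d by (intro sin_ge_zero) auto
    ultimately show ?thesis using 1 by simp
  next
    case 2
    have "1 * d \<le> a" unfolding a_def using d 2 by (intro mult_right_mono) auto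
    moreover have "a \<le> (real n - 1) * d" unfolding a_def using d assms by (intro mult_right_mono) auto
    then have "a + d \<le> pi" using d by (simp add: algebra_simps)
    ultimately have "sin (a - d) \<ge> 0" "sin (a + d) \<ge> 0" "sin a \<ge> 0" using d by (auto intro!: sin_ge_zero)
    then show ?thesis using 2 add by simp
  next
    case 3
    have "a \<le> (- 1) * d" unfolding a_def using d 3 by (intro mult_right_mono) auto
    moreover have "(1 - real n) * d \<le> a" unfolding a_def using d assms by (intro mult_right_mono) auto
    then have "- pi \<le> a - d" using d by (simp add: algebra_simps)
    ultimately have "sin (- (a - d)) \<ge> 0" "sin (- (a + d)) \<ge> 0" "sin (- a) \<ge> 0"
      using d by (auto simp del: sin_minus intro!: sin_ge_zero)
    then have "sin (a - d) \<le> 0" "sin (a + d) \<le> 0" "sin a \<le> 0"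
      by (simp_all only: sin_minus neg_0_le_iff_le)
    then show ?thesis using 3 add by (simp add: abs_of_nonpos)
  qed
  then show ?thesis unfolding eq a_def by simp
qed

text \<open>Superposition of fundamental solutions: the generator orthogonal to direction i + 1 gets
  as length the normalised second difference of \<open>H\<close> there, nonnegative by the convexity
  hypothesis.\<close>

lemma zonotope_with_support:
  fixes H :: "nat \<Rightarrow> real" and n :: nat
  assumes n: "n \<ge> 2" and d: "d = pi / n"
    and per: "\<And>i. H (i + n) = H i"
    and cvx: "\<And>i. 2 * cos d * H (i + 1) \<le> H i + H (i + 2)"
  shows "\<exists>vs. \<forall>j\<in>{1..n}. (\<Sum>v\<leftarrow>vs. \<bar>circle_vec (real j * d) \<bullet> v\<bar>) = H j"
proof -
  have sd: "sin d > 0" unfolding d using n by (intro sin_gt_zero) (auto simp: field_simps)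
  \<comment> \<open>2 sin(d) is the second difference of |sin| at its kink.\<close>
  define c where "c i = (H i + H (i + 2) - 2 * cos d * H (i + 1)) / (2 * sin d)" for i
  have c: "c i \<ge> 0" for i using cvx[of i] sd by (simp add: c_def)
  define vs where "vs = map (\<lambda>i. c i *\<^sub>R circle_vec (real (i + 1) * d + pi / 2)) [0..<n]"
  have "(\<Sum>v\<leftarrow>vs. \<bar>circle_vec (real j * d) \<bullet> v\<bar>) = H j" if j: "j \<in> {1..n}" for j
  proof -
    define g where "g i = \<bar>sin ((real i - real j) * d)\<bar>" for i :: nat
    have g_per: "g (i + n) = g i" for i
    proof -
      have "(real (i + n) - j) * d = (real i - j) * d + pi" using n d by (simp add: field_simps)
      then show ?thesis by (simp add: g_def sin_add)
    qed
    have term_eq: "\<bar>circle_vec (real j * d) \<bullet> (c i *\<^sub>R circle_vec (real (i + 1) * d + pi / 2))\<bar> = c i * g (i + 1)" for i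
    proof -
      have "circle_vec (real j * d) \<bullet> circle_vec (real (i + 1) * d + pi / 2)
          = cos (- ((real (i + 1) - real j) * d + pi / 2))"
        unfolding inner_circle_vec by (rule arg_cong[of _ _ cos]) (simp add: algebra_simps)
      also have "\<dots> = - sin ((real (i + 1) - real j) * d)" by (simp only: cos_minus cos_add) simp
      finally show ?thesis using c[of i] by (simp add: abs_mult g_def)
    qed
    have "(\<Sum>v\<leftarrow>vs. \<bar>circle_vec (real j * d) \<bullet> v\<bar>) = (\<Sum>i<n. c i * g (i + 1))"
      unfolding vs_def map_map o_def term_eq by (simp add: sum_list_sum_nth atLeast0LessThan)
    also have "\<dots> = ((\<Sum>i<n. H i * g (i + 1)) + (\<Sum>i<n. H (i + 2) * g (i + 1))
        - (\<Sum>i<n. 2 * cos d * H (i + 1) * g (i + 1))) / (2 * sin d)"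
      by (simp add: c_def sum.distrib[symmetric] sum_subtractf[symmetric] sum_divide_distrib algebra_simps
          add_divide_distrib diff_divide_distrib)
    \<comment> \<open>Summation by parts: \<open>H\<close> and \<open>g\<close> are n-periodic, so
      index shifts move the second difference from \<open>H\<close> to \<open>g\<close>, where only
      the term i + 1 = j survives.\<close>
    also have "(\<Sum>i<n. H i * g (i + 1)) = (\<Sum>i<n. H (i + 1) * g (i + 2))"
      using sum_shift_periodic[of "\<lambda>i. H i * g (i + 1)" n] per[of 0] g_per[of 1] by (simp add: add.commute)
    also have "(\<Sum>i<n. H (i + 2) * g (i + 1)) = (\<Sum>i<n. H (i + 1) * g i)"
      using sum_shift_periodic[of "\<lambda>i. H (i + 1) * g i" n] per[of 1] g_per[of 0] by (simp add: add.commute)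
    also have "(\<Sum>i<n. H (i + 1) * g (i + 2)) + (\<Sum>i<n. H (i + 1) * g i)
        - (\<Sum>i<n. 2 * cos d * H (i + 1) * g (i + 1))
      = (\<Sum>i<n. H (i + 1) * (g i + g (i + 2) - 2 * cos d * g (i + 1)))"
      by (simp add: sum.distrib[symmetric] sum_subtractf[symmetric] algebra_simps)
    also have "\<dots> = (\<Sum>i<n. H (i + 1) * (if i + 1 = j then 2 * sin d else 0))"
      using abs_sin_second_difference[OF n d] j
      by (intro sum.cong refl arg_cong2[of _ _ _ _ "(*)"]) (simp_all add: g_def)
    also have "\<dots> = (\<Sum>i\<in>{j - 1}. H (i + 1) * (if i + 1 = j then 2 * sin d else 0))"
      using j by (intro sum.mono_neutral_right) auto
    also have "\<dots> = H j * (2 * sin d)" using j by simp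
    finally show ?thesis using sd by simp
  qed
  then show ?thesis by blast
qed

lemma sum_list_abs_inner_diff:
  "(\<Sum>v\<leftarrow>vs. \<bar>u \<bullet> v\<bar>) \<le> (\<Sum>v\<leftarrow>vs. \<bar>w \<bullet> v\<bar>) + (\<Sum>v\<leftarrow>vs. \<bar>(u - w) \<bullet> v\<bar>)"
  by (induction vs) (auto simp: inner_diff_left)

lemma sum_list_abs_inner_le:
  fixes u :: R2
  shows "(\<Sum>v\<leftarrow>vs. \<bar>u \<bullet> v\<bar>) \<le> \<bar>u $ 1\<bar> * (\<Sum>v\<leftarrow>vs. \<bar>v $ 1\<bar>) + \<bar>u $ 2\<bar> * (\<Sum>v\<leftarrow>vs. \<bar>v $ 2\<bar>)"
proof (induction vs)
  case (Cons v vs)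
  have "\<bar>u \<bullet> v\<bar> \<le> \<bar>u $ 1\<bar> * \<bar>v $ 1\<bar> + \<bar>u $ 2\<bar> * \<bar>v $ 2\<bar>"
    by (simp add: inner_R2 abs_mult[symmetric])
  with Cons show ?case by (simp add: algebra_simps)
qed simp

text \<open>The zonotope is built to share the support values of \<open>K\<close> in the sampled
  directions. Every unit vector is within 2 d of such a direction up to sign; with Lipschitz
  constants R for \<open>K\<close> and 2 R for the zonotope, the values differ elsewhere by at most
  6 R d.\<close>

lemma symmetric_convex_near_zonotope:
  fixes K :: "R2 set"
  assumes K: "compact K" "convex K" "K \<noteq> {}" "\<And>x. x \<in> K \<Longrightarrow> - x \<in> K" and "e > 0"
  shows "\<exists>vs. hausdorff_near e K (zonotope 1 vs)"
proof -
  obtain R where R: "R > 0" "\<And>x. x \<in> K \<Longrightarrow> norm x \<le> R"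
    using compact_imp_bounded[OF K(1)] bounded_pos by metis
  obtain m :: nat where m: "6 * R * pi / e < real m" using reals_Archimedean2 by blast
  have "6 * R * pi / e > 0" using R \<open>e > 0\<close> by simp
  then have m0: "m > 0" using m by (cases m) auto
  \<comment> \<open>An even n puts both coordinate axes among the sampled directions, at the indices
    n and m.\<close>
  define n where "n = 2 * m"
  define d where "d = pi / n"
  have n: "n \<ge> 2" using m0 by (simp add: n_def)
  have d0: "d > 0" unfolding d_def using n by simp
  have nd: "real n * d = pi" "real m * d = pi / 2" using m0 by (simp_all add: d_def n_def)
  have "6 * R * pi < e * real m" using m \<open>e > 0\<close> by (simp add: field_simps)
  also have "\<dots> < e * real n" using m0 \<open>e > 0\<close> by (simp add: n_def)
  finally have small: "6 * R * d < e" using n by (simp add: d_def field_simps)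
  define h where "h u = Sup ((\<lambda>x. u \<bullet> x) ` K)" for u :: R2
  have att: "\<exists>x\<in>K. u \<bullet> x = h u \<and> (\<forall>y\<in>K. u \<bullet> y \<le> h u)" for u
  proof -
    have "\<exists>x\<in>K. \<forall>y\<in>K. u \<bullet> y \<le> u \<bullet> x"
      by (rule continuous_attains_sup[OF K(1,3)]) (intro continuous_intros)
    then obtain x where x: "x \<in> K" "\<And>y. y \<in> K \<Longrightarrow> u \<bullet> y \<le> u \<bullet> x" by blast
    then have "h u = u \<bullet> x" unfolding h_def by (intro cSup_eq_maximum) auto
    with x show ?thesis by auto
  qed
  have h_ge: "u \<bullet> x \<le> h u" if "x \<in> K" for u x using att[of u] that by blast
  have h_minus: "h (- u) = h u" for u
  proof -
    obtain x y where "x \<in> K" "u \<bullet> x = h u" "y \<in> K" "(- u) \<bullet> y = h (- u)"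
      using att[of u] att[of "- u"] by blast
    then show ?thesis using h_ge[OF K(4), of x "- u"] h_ge[OF K(4), of y u] by simp
  qed
  have h_le: "h u \<le> R" if "norm u = 1" for u
  proof -
    obtain x where x: "x \<in> K" "u \<bullet> x = h u" using att[of u] by blast
    then show ?thesis using norm_cauchy_schwarz[of u x] R(2)[of x] that by simp
  qed
  define H where "H i = h (circle_vec (real i * d))" for i :: nat
  have "H (i + n) = H i" for i
  proof -
    have "real (i + n) * d = real i * d + pi" using nd by (simp add: algebra_simps)
    then show ?thesis by (simp only: H_def circle_vec_add_pi h_minus)
  qed
  moreover have "2 * cos d * H (i + 1) \<le> H i + H (i + 2)" for i
  proof -
    define t where "t = real (i + 1) * d"
    have t: "real i * d = t - d" "real (i + 2) * d = t + d" by (simp_all add: t_def algebra_simps)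
    obtain x where x: "x \<in> K" "circle_vec t \<bullet> x = h (circle_vec t)" using att by blast
    have "2 * cos d * h (circle_vec t) = ((2 * cos d) *\<^sub>R circle_vec t) \<bullet> x" using x by simp
    also have "\<dots> = circle_vec (t - d) \<bullet> x + circle_vec (t + d) \<bullet> x"
      unfolding circle_vec_sum[symmetric] by (rule inner_add_left)
    also have "\<dots> \<le> h (circle_vec (t - d)) + h (circle_vec (t + d))"
      by (intro add_mono h_ge x(1))
    finally show ?thesis unfolding H_def t t_def .
  qed
  ultimately obtain vs where vs: "\<And>j. j \<in> {1..n} \<Longrightarrow> (\<Sum>v\<leftarrow>vs. \<bar>circle_vec (real j * d) \<bullet> v\<bar>) = H j"
    using zonotope_with_support[OF n d_def, of H] by metis
  define g where "g u = (\<Sum>v\<leftarrow>vs. \<bar>u \<bullet> v\<bar>)" for u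
  have H_le: "H j \<le> R" for j unfolding H_def by (rule h_le[OF norm_circle_vec])
  \<comment> \<open>The individual generators are not controlled, but \<open>g\<close> is bounded
    through its values on the two axes, where it agrees with \<open>h\<close> and is at most
    R.\<close>
  have g_le: "g u \<le> 2 * R * norm u" for u
  proof -
    have Hn: "(\<Sum>v\<leftarrow>vs. \<bar>v $ 1\<bar>) = H n"
      using vs[of n] n by (simp add: nd inner_R2)
    have Hm: "(\<Sum>v\<leftarrow>vs. \<bar>v $ 2\<bar>) = H m"
      using vs[of m] m0 by (simp add: nd inner_R2 n_def)
    have pos: "0 \<le> H n" "0 \<le> H m"
      unfolding Hn[symmetric] Hm[symmetric] by (rule sum_list_nonneg; auto)+
    have "g u \<le> \<bar>u $ 1\<bar> * H n + \<bar>u $ 2\<bar> * H m"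
      using sum_list_abs_inner_le[of u vs] unfolding Hn Hm g_def .
    also have "\<dots> \<le> norm u * R + norm u * R"
      using pos by (intro add_mono mult_mono component_le_norm_cart H_le norm_ge_zero)
    finally show ?thesis by simp
  qed
  have g_diff: "g u \<le> g w + 2 * R * norm (u - w)" for u w
    using sum_list_abs_inner_diff[of u vs w] g_le[of "u - w"] by (simp add: g_def)
  have net: "\<exists>w. norm (u - w) \<le> 2 * d \<and> g w = h w" if u: "norm u = 1" for u
  proof -
    obtain s t where st: "s = 1 \<or> s = -1" "0 < t" "t \<le> pi" "u = s *\<^sub>R circle_vec t"
      using unit_vec_eq_circle_vec[OF u] .
    define j where "j = nat \<lceil>t / d\<rceil>"
    have "0 < t / d" "t / d \<le> real n" using st d0 nd by (simp_all add: field_simps)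
    then have j: "j \<in> {1..n}" "t / d \<le> real j" "real j \<le> t / d + 1"
      unfolding j_def by (auto simp: le_nat_iff ceiling_le_iff)
    then have "\<bar>t - real j * d\<bar> \<le> d" using d0 by (auto simp: field_simps abs_le_iff)
    then have nrm: "norm (circle_vec t - circle_vec (real j * d)) \<le> 2 * d"
      by (intro order_trans[OF norm_circle_vec_diff]) simp
    have gh: "g (circle_vec (real j * d)) = h (circle_vec (real j * d))"
      using vs[OF j(1)] by (simp add: g_def H_def)
    show ?thesis
    proof (cases "s = 1")
      case True
      then show ?thesis using nrm gh st by (intro exI[of _ "circle_vec (real j * d)"]) simp
    next
      case False
      have "g (- circle_vec (real j * d)) = h (- circle_vec (real j * d))"
        using gh h_minus by (simp add: g_def)
      moreover have "u - - circle_vec (real j * d) = - (circle_vec t - circle_vec (real j * d))"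
        using st False by simp
      ultimately show ?thesis using nrm by (metis norm_minus_cancel)
    qed
  qed
  have inner_diff: "u \<bullet> x \<le> w \<bullet> x + R * norm (u - w)" if "x \<in> K" for u w x
  proof -
    have "(u - w) \<bullet> x \<le> norm (u - w) * R"
      using norm_cauchy_schwarz[of "u - w" x] mult_left_mono[OF R(2)[OF that], of "norm (u - w)"] by simp
    then show ?thesis by (simp add: inner_diff_left mult.commute)
  qed
  let ?Z = "zonotope 1 vs"
  have KZ: "\<exists>z\<in>?Z. u \<bullet> x \<le> u \<bullet> z + 6 * R * d" if u: "norm u = 1" and x: "x \<in> K" for u x
  proof -
    obtain w where w: "norm (u - w) \<le> 2 * d" "g w = h w" using net[OF u] by blast
    obtain z where z: "z \<in> ?Z" "u \<bullet> z = g u"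
      using inner_zonotope_attained[of vs u] by (auto simp: g_def)
    have "norm (w - u) \<le> 2 * d" using w(1) by (simp add: norm_minus_commute)
    then have "R * norm (u - w) \<le> 2 * R * d" "2 * R * norm (w - u) \<le> 4 * R * d"
      using mult_left_mono[OF w(1), of R] R(1) by (simp_all add: algebra_simps norm_minus_commute)
    then show ?thesis using inner_diff[OF x, of u w] h_ge[OF x, of w] g_diff[of w u] w(2) z
      by (intro bexI[of _ z]) auto
  qed
  have ZK: "\<exists>x\<in>K. u \<bullet> z \<le> u \<bullet> x + 6 * R * d" if u: "norm u = 1" and z: "z \<in> ?Z" for u z
  proof -
    obtain w where w: "norm (u - w) \<le> 2 * d" "g w = h w" using net[OF u] by blast
    obtain x where x: "x \<in> K" "w \<bullet> x = h w" using att by blast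
    have "norm (w - u) \<le> 2 * d" using w(1) by (simp add: norm_minus_commute)
    then have "R * norm (w - u) \<le> 2 * R * d" "2 * R * norm (u - w) \<le> 4 * R * d"
      using mult_left_mono[OF w(1), of R] R(1) by (simp_all add: algebra_simps norm_minus_commute)
    then show ?thesis
      using inner_diff[OF x(1), of w u] inner_zonotope_le[OF z, of u] g_diff[of u w] w(2) x
      by (intro bexI[of _ x]) (auto simp: g_def)
  qed
  have pos: "6 * R * d \<ge> 0" using R d0 by simp
  have "\<exists>z\<in>?Z. dist x z \<le> 6 * R * d" if "x \<in> K" for x
    using zero_in_zonotope[of 1 vs]
    by (intro support_dominated_imp_near[OF compact_imp_closed[OF compact_zonotope] convex_zonotope _ KZ that pos]) auto
  moreover have "\<exists>x\<in>K. dist z x \<le> 6 * R * d" if "z \<in> ?Z" for z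
    by (intro support_dominated_imp_near[OF compact_imp_closed[OF K(1)] K(2,3) ZK that pos]) auto
  ultimately have "hausdorff_near e K ?Z"
    by (rule hausdorff_nearI[OF _ _ small])
  then show ?thesis by blast
qed

text \<open>The first coordinate is odd so that the integer functional which vanishes on \<open>odd_vec p\<close> takes a
  half-integer value at the point \<open>(0, 1/2)\<close>, simultaneously for all \<open>p\<close>.\<close>

definition odd_vec :: "int \<times> int \<Rightarrow> R2" where
  "odd_vec p = vector [2 * of_int (fst p) + 1, 2 * of_int (snd p)]"

lemma odd_vec_near:
  assumes "r > 0"
  shows "\<exists>p. norm (v - r *\<^sub>R odd_vec p) \<le> 4 * r"
proof -
  define a b where "a = \<lfloor>v $ 1 / (2 * r)\<rfloor>" and "b = \<lfloor>v $ 2 / (2 * r)\<rfloor>"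
  have "of_int a \<le> v $ 1 / (2 * r)" "v $ 1 / (2 * r) < of_int a + 1"
    "of_int b \<le> v $ 2 / (2 * r)" "v $ 2 / (2 * r) < of_int b + 1"
    unfolding a_def b_def by linarith+
  then have "2 * r * of_int a \<le> v $ 1" "v $ 1 < 2 * r * (of_int a + 1)"
    "2 * r * of_int b \<le> v $ 2" "v $ 2 < 2 * r * (of_int b + 1)"
    using assms by (simp_all add: field_simps)
  then have "\<bar>v $ 1 - r * (2 * of_int a + 1)\<bar> \<le> 2 * r" "\<bar>v $ 2 - r * (2 * of_int b)\<bar> \<le> 2 * r"
    using assms by (auto simp: abs_le_iff algebra_simps)
  then have "norm (v - r *\<^sub>R odd_vec (a, b)) \<le> 4 * r"
    using norm_le_l1_cart[of "v - r *\<^sub>R odd_vec (a, b)"] by (simp add: sum_2 odd_vec_def)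
  then show ?thesis by blast
qed

text \<open>Points with equal coefficients are matched; each generator contributes an error of at
  most 4 r.\<close>

lemma zonotope_near_odd_zonotope:
  assumes "r > 0"
  shows "\<exists>ps. (\<forall>z\<in>zonotope 1 vs. \<exists>y\<in>zonotope 1 (map odd_vec ps). norm (z - r *\<^sub>R y) \<le> 4 * r * real (length vs))
    \<and> (\<forall>y\<in>zonotope 1 (map odd_vec ps). \<exists>z\<in>zonotope 1 vs. norm (z - r *\<^sub>R y) \<le> 4 * r * real (length vs))"
proof (induction vs)
  case Nil
  show ?case by (intro exI[of _ "[]"]) simp
next
  case (Cons v vs)
  then obtain ps where ps: "\<And>z. z \<in> zonotope 1 vs \<Longrightarrow> \<exists>y\<in>zonotope 1 (map odd_vec ps). norm (z - r *\<^sub>R y) \<le> 4 * r * real (length vs)"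
    "\<And>y. y \<in> zonotope 1 (map odd_vec ps) \<Longrightarrow> \<exists>z\<in>zonotope 1 vs. norm (z - r *\<^sub>R y) \<le> 4 * r * real (length vs)" by blast
  obtain p where p: "norm (v - r *\<^sub>R odd_vec p) \<le> 4 * r" using odd_vec_near[OF assms] by blast
  have est: "norm ((t *\<^sub>R v + z) - r *\<^sub>R (t *\<^sub>R odd_vec p + y)) \<le> 4 * r * real (length (v # vs))"
    if "\<bar>t\<bar> \<le> 1" "norm (z - r *\<^sub>R y) \<le> 4 * r * real (length vs)" for t y z
  proof -
    have "(t *\<^sub>R v + z) - r *\<^sub>R (t *\<^sub>R odd_vec p + y) = t *\<^sub>R (v - r *\<^sub>R odd_vec p) + (z - r *\<^sub>R y)"
      by (simp add: algebra_simps)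
    moreover have "norm (t *\<^sub>R (v - r *\<^sub>R odd_vec p)) \<le> 1 * (4 * r)"
      using that(1) p unfolding norm_scaleR by (intro mult_mono) auto
    ultimately show ?thesis using that(2)
        norm_triangle_ineq[of "t *\<^sub>R (v - r *\<^sub>R odd_vec p)" "z - r *\<^sub>R y"] by (simp add: algebra_simps)
  qed
  show ?case
  proof (intro exI[of _ "p # ps"] conjI ballI)
    fix z assume "z \<in> zonotope 1 (v # vs)"
    then obtain t z' where z: "z = t *\<^sub>R v + z'" "\<bar>t\<bar> \<le> 1" "z' \<in> zonotope 1 vs" by auto
    with ps(1) obtain y where "y \<in> zonotope 1 (map odd_vec ps)" "norm (z' - r *\<^sub>R y) \<le> 4 * r * real (length vs)" by blast
    with z est show "\<exists>y\<in>zonotope 1 (map odd_vec (p # ps)). norm (z - r *\<^sub>R y) \<le> 4 * r * real (length (v # vs))"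
      by (intro bexI[of _ "t *\<^sub>R odd_vec p + y"]) auto
  next
    fix y assume "y \<in> zonotope 1 (map odd_vec (p # ps))"
    then obtain t y' where y: "y = t *\<^sub>R odd_vec p + y'" "\<bar>t\<bar> \<le> 1" "y' \<in> zonotope 1 (map odd_vec ps)" by auto
    with ps(2) obtain z where "z \<in> zonotope 1 vs" "norm (z - r *\<^sub>R y') \<le> 4 * r * real (length vs)" by blast
    with y est show "\<exists>z\<in>zonotope 1 (v # vs). norm (z - r *\<^sub>R y) \<le> 4 * r * real (length (v # vs))"
      by (intro bexI[of _ "t *\<^sub>R v + z"]) auto
  qed
qed

lemma point_symmetric_convex_near_odd_zonotope:
  assumes K: "compact K" "convex K" "K \<noteq> {}" "point_symmetric K" and "e > 0"
  shows "\<exists>ps r c. r > 0 \<and> hausdorff_near e ((\<lambda>z. r *\<^sub>R z + c) ` zonotope 1 (map odd_vec ps)) K"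
proof -
  obtain c where c: "\<And>x. x \<in> K \<Longrightarrow> 2 *\<^sub>R c - x \<in> K" using K(4) by (auto simp: point_symmetric_def)
  define K' where "K' = (\<lambda>x. - c + x) ` K"
  have "compact K'" "convex K'" "K' \<noteq> {}"
    unfolding K'_def using K compact_translation[OF K(1), of "- c"] convex_translation[OF K(2), of "- c"]
    by simp_all
  moreover have "- x \<in> K'" if x: "x \<in> K'" for x
  proof -
    obtain y where y: "y \<in> K" "x = - c + y" using x unfolding K'_def by blast
    have "- x = - c + (2 *\<^sub>R c - y)" by (simp add: y(2) scaleR_2)
    with c[OF y(1)] show ?thesis unfolding K'_def by blast
  qed
  ultimately obtain vs where vs: "hausdorff_near (e/2) K' (zonotope 1 vs)"
    using symmetric_convex_near_zonotope[of K' "e/2"] \<open>e > 0\<close> by auto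
  define r where "r = e / (8 * (real (length vs) + 1))"
  have r: "r > 0" using \<open>e > 0\<close> by (simp add: r_def add_pos_nonneg)
  have small: "4 * r * real (length vs) < e / 2"
    using \<open>e > 0\<close> by (simp add: r_def field_simps add_pos_nonneg)
  obtain ps where ps: "\<And>z. z \<in> zonotope 1 vs \<Longrightarrow> \<exists>y\<in>zonotope 1 (map odd_vec ps). norm (z - r *\<^sub>R y) \<le> 4 * r * real (length vs)"
    "\<And>y. y \<in> zonotope 1 (map odd_vec ps) \<Longrightarrow> \<exists>z\<in>zonotope 1 vs. norm (z - r *\<^sub>R y) \<le> 4 * r * real (length vs)"
    using zonotope_near_odd_zonotope[OF r, of vs] by blast
  have "hausdorff_near (e/2) (zonotope 1 vs) ((\<lambda>z. r *\<^sub>R z) ` zonotope 1 (map odd_vec ps))"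
  proof (rule hausdorff_nearI[OF _ _ small])
    fix z assume "z \<in> zonotope 1 vs"
    then show "\<exists>y\<in>(\<lambda>z. r *\<^sub>R z) ` zonotope 1 (map odd_vec ps). dist z y \<le> 4 * r * real (length vs)"
      using ps(1) by (auto simp: dist_norm)
  next
    fix y assume "y \<in> (\<lambda>z. r *\<^sub>R z) ` zonotope 1 (map odd_vec ps)"
    then show "\<exists>z\<in>zonotope 1 vs. dist y z \<le> 4 * r * real (length vs)"
      using ps(2) by (auto simp: dist_norm norm_minus_commute)
  qed
  from hausdorff_near_trans[OF vs this]
  have "hausdorff_near e K' ((\<lambda>z. r *\<^sub>R z) ` zonotope 1 (map odd_vec ps))" by simp
  from hausdorff_near_affine[OF this, of 1 c]
  have "hausdorff_near e K ((\<lambda>z. r *\<^sub>R z + c) ` zonotope 1 (map odd_vec ps))"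
    by (simp add: K'_def image_image)
  with r show ?thesis using hausdorff_near_sym by blast
qed

section \<open>Density\<close>

text \<open>The parameters \<open>ps\<close> and \<open>j\<close> range over countable types, as
  genericity demands. The lower bound on \<open>r\<close> forces diameters to infinity, the error is
  relative to \<open>r\<close>, and the translation \<open>c\<close> is left free.\<close>

definition tracks :: "(R2 \<Rightarrow> R2) \<Rightarrow> (int \<times> int) list \<Rightarrow> nat \<Rightarrow> bool" where
  "tracks F ps j \<longleftrightarrow> (\<exists>n r c e. real (Suc j) \<le> r \<and> e < r / real (Suc j) \<and>
     hausdorff_near e ((F ^^ n) ` unit_square) ((\<lambda>z. r *\<^sub>R z + c) ` zonotope 1 (map odd_vec ps)))"

text \<open>Only \<open>F\<close> is evaluated at two nearby points, so its uniform continuity gives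
  one \<open>d\<close> for all perturbations \<open>G\<close>.\<close>

lemma funpow_perturbation:
  assumes "uniformly_continuous_on UNIV (F :: R2 \<Rightarrow> R2)" "e > 0"
  shows "\<exists>d>0. \<forall>G. (\<forall>x. norm (F x - G x) < d) \<longrightarrow> (\<forall>x. norm ((F ^^ n) x - (G ^^ n) x) < e)"
  using assms(2)
proof (induction n arbitrary: e)
  case 0
  then show ?case by (intro exI[of _ 1]) auto
next
  case (Suc n)
  have e2: "e / 2 > 0" using Suc.prems by simp
  then obtain \<eta> where \<eta>: "\<eta> > 0" "\<And>x y. dist y x < \<eta> \<Longrightarrow> dist (F y) (F x) < e / 2"
    using assms(1) unfolding uniformly_continuous_on_def by (metis UNIV_I)
  obtain d where d: "d > 0" "\<And>G x. (\<And>x. norm (F x - G x) < d) \<Longrightarrow> norm ((F ^^ n) x - (G ^^ n) x) < \<eta>"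
    using Suc.IH[OF \<eta>(1)] by blast
  have "norm ((F ^^ Suc n) x - (G ^^ Suc n) x) < e" if G: "\<And>x. norm (F x - G x) < min d (e / 2)" for G x
  proof -
    have "dist ((F ^^ n) x) ((G ^^ n) x) < \<eta>" unfolding dist_norm by (rule d(2)) (use G in auto)
    then have "dist (F ((F ^^ n) x)) (F ((G ^^ n) x)) < e / 2" by (rule \<eta>(2))
    moreover have "dist (F ((G ^^ n) x)) (G ((G ^^ n) x)) < e / 2"
      using G[of "(G ^^ n) x"] by (simp add: dist_norm)
    ultimately show ?thesis
      using dist_triangle_less_add[of "F ((F ^^ n) x)" "F ((G ^^ n) x)" "e/2" "G ((G ^^ n) x)" "e/2"]
      by (simp add: dist_norm norm_minus_commute)
  qed
  then show ?case using d(1) e2 by (intro exI[of _ "min d (e / 2)"]) auto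
qed

lemma lift_diff_uniformly_continuous: "lift_diff F \<Longrightarrow> uniformly_continuous_on UNIV F"
  by (rule lift_uniformly_continuous) (auto simp: lift_diff_def smooth_continuous_on)

text \<open>\<open>tracks\<close> involves no derivatives and its strict inequality leaves room, so
  closeness in \<open>cdist 0\<close> preserves it.\<close>

lemma Cinf_open_in_tracks:
  assumes "\<And>F. F \<in> A \<Longrightarrow> lift_diff F"
  shows "Cinf_open_in A {F \<in> A. tracks F ps j}"
  unfolding Cinf_open_in_def
proof (intro conjI ballI)
  fix F assume "F \<in> {F \<in> A. tracks F ps j}"
  then have F: "F \<in> A" "tracks F ps j" by auto
  define Z where "Z = zonotope 1 (map odd_vec ps)"
  obtain n r c e where t: "real (Suc j) \<le> r" "e < r / real (Suc j)"
    "hausdorff_near e ((F ^^ n) ` unit_square) ((\<lambda>z. r *\<^sub>R z + c) ` Z)"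
    using F(2) unfolding tracks_def Z_def by blast
  obtain e' where e': "e < e'" "e' < r / real (Suc j)" using dense[OF t(2)] by blast
  define \<eta> where "\<eta> = e' - e"
  have \<eta>: "\<eta> > 0" "\<eta> + e < r / real (Suc j)" using e' by (simp_all add: \<eta>_def)
  obtain d where d: "d > 0" "\<And>G x. (\<And>x. norm (F x - G x) < d) \<Longrightarrow> norm ((F ^^ n) x - (G ^^ n) x) < \<eta>"
    using funpow_perturbation[OF lift_diff_uniformly_continuous[OF assms[OF F(1)]] \<eta>(1), of n] by blast
  have "tracks G ps j" if G: "cdist 0 F G < ereal d" for G
  proof -
    have "norm ((F ^^ n) x - (G ^^ n) x) < \<eta>" for x
      by (rule d(2)) (rule cdist_norm_le[OF G])
    then have "hausdorff_near \<eta> ((G ^^ n) ` unit_square) ((F ^^ n) ` unit_square)"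
      unfolding hausdorff_near_def dist_norm by (auto simp: norm_minus_commute)
    from hausdorff_near_trans[OF this t(3)] show ?thesis
      unfolding tracks_def using t(1) \<eta>(2) Z_def by blast
  qed
  then show "\<exists>k. \<exists>\<epsilon>>0. {G \<in> A. cdist k F G < ereal \<epsilon>} \<subseteq> {F \<in> A. tracks F ps j}"
    using d(1) by blast
qed blast

section \<open>Perturbing a conjugate of a translation\<close>

lemma lattice_diff_inv:
  assumes "lattice_diff q h" "real q *\<^sub>R k \<in> intvecs"
  shows "inv h (x + k) = inv h x + k"
proof -
  have h: "bij h" "h (inv h x + k) = h (inv h x) + k" using assms by (auto simp: lattice_diff_def)
  then have "h (inv h x + k) = x + k" by (simp add: bij_is_surj surj_f_inv_f)
  then show ?thesis using h(1) by (metis bij_inv_eq_iff)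
qed

lemma torus_diff_lift_comp:
  assumes "torus_diff_lift H" "lattice_diff q h"
  shows "torus_diff_lift (H \<circ> h)"
proof -
  have bij: "bij H" "bij h" using assms by (auto simp: torus_diff_lift_def lattice_diff_def)
  have "inv (H \<circ> h) = inv h \<circ> inv H" using bij by (simp add: o_inv_distrib)
  moreover have "inv h (inv H (x + k)) - inv h (inv H x) \<in> intvecs" if "k \<in> intvecs" for x k
  proof -
    define m where "m = inv H (x + k) - inv H x"
    have "m \<in> intvecs" using assms(1) that by (simp add: torus_diff_lift_def m_def)
    then show ?thesis
      using lattice_diff_inv[OF assms(2) intvecs_lattice, of m "inv H x"] by (simp add: m_def)
  qed
  ultimately show ?thesis
    using assms by (auto simp: torus_diff_lift_def lattice_diff_def smooth_comp bij_comp intvecs_lattice)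
qed

lemma conj_rot_lattice_comp:
  assumes "bij H" "lattice_diff q h" "real q *\<^sub>R \<theta> \<in> intvecs"
  shows "conj_rot \<theta> (H \<circ> h) = conj_rot \<theta> H"
proof -
  have h: "bij h" "\<And>x. h (x + \<theta>) = h x + \<theta>" using assms by (auto simp: lattice_diff_def)
  have "inv (H \<circ> h) = inv h \<circ> inv H" using assms(1) h(1) by (simp add: o_inv_distrib)
  then show ?thesis by (simp add: conj_rot_def fun_eq_iff h bij_is_surj[OF h(1)] surj_f_inv_f)
qed

lemma rational_rotation_near:
  assumes "d > 0"
  shows "\<exists>q \<theta>'. q > 0 \<and> real q *\<^sub>R \<theta>' \<in> intvecs \<and> norm (\<theta>' - \<theta>) < d"
proof -
  obtain q :: nat where q: "2 / d < real q" using reals_Archimedean2 by blast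
  have "2 / d > 0" using assms by simp
  then have q0: "q > 0" using q by (cases q) auto
  define \<theta>' :: R2 where "\<theta>' = (\<chi> i. of_int \<lfloor>real q * \<theta> $ i\<rfloor> / real q)"
  have lat: "real q *\<^sub>R \<theta>' \<in> intvecs" using q0 by (simp add: intvecs_def \<theta>'_def)
  have "\<bar>(\<theta>' - \<theta>) $ i\<bar> \<le> 1 / real q" for i
  proof -
    have "of_int \<lfloor>real q * \<theta> $ i\<rfloor> \<le> real q * \<theta> $ i" "real q * \<theta> $ i < of_int \<lfloor>real q * \<theta> $ i\<rfloor> + 1" by linarith+
    then have "\<bar>of_int \<lfloor>real q * \<theta> $ i\<rfloor> - real q * \<theta> $ i\<bar> \<le> 1" by linarith
    moreover have "(\<theta>' - \<theta>) $ i = (of_int \<lfloor>real q * \<theta> $ i\<rfloor> - real q * \<theta> $ i) / real q"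
      using q0 by (simp add: \<theta>'_def field_simps)
    ultimately show ?thesis by (simp add: divide_right_mono)
  qed
  from add_mono[OF this[of 1] this[of 2]] have "norm (\<theta>' - \<theta>) \<le> 2 / real q"
    by (intro order_trans[OF norm_le_l1_cart]) (simp add: sum_2)
  moreover have "2 / real q < d" using q q0 assms by (simp add: field_simps)
  ultimately show ?thesis using q0 lat by (intro exI[of _ q] exI[of _ \<theta>']) auto
qed

text \<open>The shears run along \<open>B v\<close> because the outer conjugacy, with linear part
  \<open>A\<close>, turns \<open>B v\<close> back into \<open>v\<close>.\<close>

lemma exists_lattice_diff_with_zonotope_displacements:
  assumes AB: "linear A" "linear B" "\<And>x. A (B x) = x"
    "\<And>k. k \<in> intvecs \<Longrightarrow> A k \<in> intvecs" "\<And>k. k \<in> intvecs \<Longrightarrow> B k \<in> intvecs"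
    and "q > 0" "M > 0"
  shows "\<exists>h \<gamma>. lattice_diff q h \<and>
    (\<forall>x. h (x + \<gamma>) - h x - \<gamma> \<in> zonotope (real M) (map B (map odd_vec ps))) \<and>
    (\<forall>z\<in>int_combinations M (map B (map odd_vec ps)). \<exists>y. norm (h (y + \<gamma>) - h y - \<gamma> - z) < 1)"
proof -
  \<comment> \<open>\<open>odd_vec p\<close> turned by a right angle. The factor q in
    \<open>l\<close> makes the functional integral on vectors of denominator q.\<close>
  define w :: "int \<times> int \<Rightarrow> R2" where "w p = vector [- 2 * of_int (snd p), 2 * of_int (fst p) + 1]" for p
  define l where "l p x = real q * (w p \<bullet> A x)" for p x
  \<comment> \<open>\<open>l p\<close> at this point is half the odd entry of \<open>w p\<close>, a
    half-integer for every \<open>p\<close>.\<close>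
  define \<gamma> where "\<gamma> = (1 / real q) *\<^sub>R B (vector [0, 1/2])"
  define Q where "Q = map (\<lambda>p. (B (odd_vec p), l p)) ps"
  have fst: "map fst Q = map B (map odd_vec ps)" by (simp add: Q_def)
  have lin: "linear (l p)" for p
    by (rule linearI) (simp_all add: l_def linear_add[OF AB(1)] linear_cmul[OF AB(1)] inner_add_right algebra_simps)
  have "odd_vec p \<in> intvecs" for p by (auto simp: odd_vec_def intvecs_def forall_2)
  then have B: "B (odd_vec p) \<in> intvecs" for p using AB(5) by blast
  have l0: "l p (B (odd_vec p)) = 0" for p
    by (simp add: l_def AB(3) w_def odd_vec_def inner_R2 algebra_simps)
  have half: "l p \<gamma> - 1/2 \<in> \<int>" for p
  proof -
    have "l p \<gamma> = w p \<bullet> vector [0, 1/2]"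
      using \<open>q > 0\<close> by (simp add: l_def \<gamma>_def linear_cmul[OF AB(1)] AB(3))
    also have "\<dots> = of_int (fst p) + 1/2" by (simp add: inner_R2 w_def field_simps)
    finally show ?thesis by simp
  qed
  have int: "l p k \<in> \<int>" if k: "real q *\<^sub>R k \<in> intvecs" for p k
  proof -
    have "l p k = w p \<bullet> A (real q *\<^sub>R k)" by (simp add: l_def linear_cmul[OF AB(1)])
    moreover have "A (real q *\<^sub>R k) \<in> intvecs" using AB(4) k by blast
    then have "A (real q *\<^sub>R k) $ 1 \<in> \<int>" "A (real q *\<^sub>R k) $ 2 \<in> \<int>" by (auto simp: intvecs_def)
    ultimately show ?thesis by (simp add: inner_R2 w_def)
  qed
  have "\<exists>h. lattice_diff q h \<and> (\<forall>x. h x - x \<in> zonotope (real M / 2) (map fst Q)) \<and>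
     (\<forall>z\<in>int_combinations M (map fst Q). \<exists>y. norm (h (y + \<gamma>) - h y - \<gamma> - z) < 1)"
    using B lin l0 half int \<open>M > 0\<close>
    by (intro exists_lattice_diff_with_displacements) (auto simp: Q_def)
  then obtain h where h: "lattice_diff q h" "\<And>x. h x - x \<in> zonotope (real M / 2) (map fst Q)"
    "\<forall>z\<in>int_combinations M (map fst Q). \<exists>y. norm (h (y + \<gamma>) - h y - \<gamma> - z) < 1" by blast
  have "h (x + \<gamma>) - h x - \<gamma> \<in> zonotope (real M) (map fst Q)" for x
  proof -
    have "h (x + \<gamma>) - h x - \<gamma> = (h (x + \<gamma>) - (x + \<gamma>)) - (h x - x)" by simp
    moreover have "\<dots> \<in> zonotope (real M / 2 + real M / 2) (map fst Q)" by (rule zonotope_diff[OF h(2) h(2)])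
    ultimately show ?thesis by (simp only: field_sum_of_halves)
  qed
  with h show ?thesis unfolding fst by blast
qed

text \<open>The conjugacy \<open>H \<circ> h\<close> is chosen before the iterate \<open>n\<close>: the rotation by \<open>\<theta>0 + \<gamma>/n\<close> is
  as close to the one by \<open>\<theta>0\<close> as needed, while its \<open>n\<close>-th iterate differs from the rotation by \<open>\<gamma>\<close>
  only by a translation which commutes with \<open>h\<close>.\<close>

lemma tracking_conj_rot_near:
  assumes H: "torus_diff_lift H" and "\<epsilon> > 0"
  shows "\<exists>h \<theta>' q. lattice_diff q h \<and> tracks (conj_rot \<theta>' (H \<circ> h)) ps j \<and>
     cdist k (conj_rot \<theta> H) (conj_rot \<theta>' (H \<circ> h)) < ereal \<epsilon>"
proof -
  have bij: "bij H" using H by (simp add: torus_diff_lift_def)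
  have \<epsilon>2: "\<epsilon> / 2 > 0" using assms(2) by simp
  obtain d where d: "d > 0" "\<And>\<theta>'. norm (\<theta>' - \<theta>) < d \<Longrightarrow> cdist k (conj_rot \<theta> H) (conj_rot \<theta>' H) < ereal (\<epsilon> / 2)"
    using cdist_conj_rot_continuous[OF H \<epsilon>2] by blast
  obtain q \<theta>0 where q: "q > 0" "real q *\<^sub>R \<theta>0 \<in> intvecs" "norm (\<theta>0 - \<theta>) < d"
    using rational_rotation_near[OF d(1)] by blast
  obtain A B C where AB: "linear A" "linear B" "\<And>x. A (B x) = x" "\<And>x. B (A x) = x"
    "\<And>k. k \<in> intvecs \<Longrightarrow> A k \<in> intvecs" "\<And>k. k \<in> intvecs \<Longrightarrow> B k \<in> intvecs"
    "\<And>x k. k \<in> intvecs \<Longrightarrow> H (x + k) = H x + A k"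
    "\<And>x k. k \<in> intvecs \<Longrightarrow> inv H (x + k) = inv H x + B k"
    "\<And>x. norm (H x - A x) \<le> C"
    using torus_diff_lift_linear_part[OF H] by blast
  obtain a where a: "a > 0" "\<And>x. norm (A x) \<le> norm x * a"
    using bounded_linear.pos_bounded[OF linear_conv_bounded_linear[THEN iffD1, OF AB(1)]] by blast
  have "bounded (inv H ` unit_square)"
    using H by (intro compact_imp_bounded compact_continuous_image smooth_continuous_on compact_unit_square)
      (simp add: torus_diff_lift_def)
  then obtain C1 where C1: "\<And>x. x \<in> unit_square \<Longrightarrow> norm (inv H x) \<le> C1" by (auto simp: bounded_iff)
  define vs where "vs = map odd_vec ps"
  define L where "L = (\<Sum>v\<leftarrow>vs. norm v)"
  \<comment> \<open>C is for replacing \<open>H\<close> by \<open>A\<close>, C1 * a for the starting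
    point \<open>inv H x\<close>, a for missing an integer combination by less than 1 before
    \<open>A\<close> is applied, and L for rounding to integer coefficients.\<close>
  define E where "E = C + C1 * a + a + L"
  \<comment> \<open>\<open>\<bar>E\<bar> + 2\<close> dominates both 1 and E + 1, so one choice of
    \<open>M\<close> meets both size conditions in \<open>tracks\<close>.\<close>
  obtain M :: nat where M: "real (Suc j) * (\<bar>E\<bar> + 2) < real M" using reals_Archimedean2 by blast
  have "real (Suc j) * 1 \<le> real (Suc j) * (\<bar>E\<bar> + 2)" by (intro mult_left_mono) auto
  from le_less_trans[OF this M] have Mj: "real (Suc j) \<le> real M" by simp
  then have "M > 0" by simp
  have ME: "E + 1 < real M / real (Suc j)"
  proof -
    have "real (Suc j) * (E + 1) \<le> real (Suc j) * (\<bar>E\<bar> + 2)" by (intro mult_left_mono) auto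
    from le_less_trans[OF this M] show ?thesis by (simp add: pos_less_divide_eq mult.commute)
  qed
  obtain h \<gamma> where h: "lattice_diff q h"
    "\<And>x. h (x + \<gamma>) - h x - \<gamma> \<in> zonotope (real M) (map B vs)"
    "\<And>z. z \<in> int_combinations M (map B vs) \<Longrightarrow> \<exists>y. norm (h (y + \<gamma>) - h y - \<gamma> - z) < 1"
    using exists_lattice_diff_with_zonotope_displacements[OF AB(1-3,5,6) q(1) \<open>M > 0\<close>, of ps] unfolding vs_def by blast
  have bijh: "bij h" using h(1) by (simp add: lattice_diff_def)
  have Hh: "torus_diff_lift (H \<circ> h)" by (rule torus_diff_lift_comp[OF H h(1)])
  have inv_Hh: "inv (H \<circ> h) = inv h \<circ> inv H" using bij bijh by (simp add: o_inv_distrib)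
  obtain d' where d': "d' > 0" "\<And>\<theta>'. norm (\<theta>' - \<theta>0) < d' \<Longrightarrow>
      cdist k (conj_rot \<theta>0 (H \<circ> h)) (conj_rot \<theta>' (H \<circ> h)) < ereal (\<epsilon> / 2)"
    using cdist_conj_rot_continuous[OF Hh \<epsilon>2] by blast
  obtain n :: nat where n: "norm \<gamma> / d' < real n" using reals_Archimedean2 by blast
  have "0 \<le> norm \<gamma> / d'" using d'(1) by simp
  then have n0: "n > 0" using n by (cases n) auto
  define \<theta>' where "\<theta>' = \<theta>0 + (1 / real n) *\<^sub>R \<gamma>"
  define G where "G = conj_rot \<theta>' (H \<circ> h)"
  have "norm (\<theta>' - \<theta>0) < d'" using n n0 d'(1) by (simp add: \<theta>'_def field_simps)
  then have "cdist k (conj_rot \<theta>0 H) G < ereal (\<epsilon> / 2)"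
    unfolding G_def using d'(2) conj_rot_lattice_comp[OF bij h(1) q(2)] by simp
  moreover have "cdist k (conj_rot \<theta> H) (conj_rot \<theta>0 H) < ereal (\<epsilon> / 2)" by (rule d(2)[OF q(3)])
  moreover have "cdist k (conj_rot \<theta> H) G \<le> cdist k (conj_rot \<theta> H) (conj_rot \<theta>0 H) + cdist k (conj_rot \<theta>0 H) G"
    using lift_diff_conj_rot[OF H] lift_diff_conj_rot[OF Hh]
    by (intro cdist_triangle) (auto simp: G_def lift_diff_def)
  moreover have "ereal (\<epsilon> / 2) + ereal (\<epsilon> / 2) = ereal \<epsilon>" by simp
  ultimately have close: "cdist k (conj_rot \<theta> H) G < ereal \<epsilon>"
    by (metis ereal_add_strict_mono2 le_less_trans)
  have "real q *\<^sub>R (real n *\<^sub>R \<theta>0) = real_of_int (int n) *\<^sub>R (real q *\<^sub>R \<theta>0)" by simp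
  then have lat: "real q *\<^sub>R (real n *\<^sub>R \<theta>0) \<in> intvecs" using intvecs_scale[OF q(2)] by metis
  define c where "c = A (real n *\<^sub>R \<theta>0 + \<gamma>)"
  define D where "D z = h (z + \<gamma>) - h z - \<gamma>" for z
  \<comment> \<open>\<open>h\<close> also commutes with n times \<open>\<theta>0\<close>, so below
    \<open>H\<close> the iterate moves \<open>inv H x\<close> by \<open>D z\<close> and a fixed
    translation.\<close>
  have est: "dist ((G ^^ n) x) (A (D z) + c) \<le> C + C1 * a"
    if x: "x \<in> unit_square" and z: "h z = inv H x" for x z
  proof -
    have zz: "inv h (inv H x) = z" using bijh z by (metis bij_inv_eq_iff)
    have "(G ^^ n) x = conj_rot (real n *\<^sub>R \<theta>0 + \<gamma>) (H \<circ> h) x"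
      unfolding G_def using Hh n0 by (simp add: conj_rot_funpow torus_diff_lift_def \<theta>'_def scaleR_add_right)
    also have "\<dots> = H (h (z + (real n *\<^sub>R \<theta>0 + \<gamma>)))" by (simp add: conj_rot_def inv_Hh zz)
    also have "z + (real n *\<^sub>R \<theta>0 + \<gamma>) = (z + \<gamma>) + real n *\<^sub>R \<theta>0" by (simp add: algebra_simps)
    also have "h \<dots> = h (z + \<gamma>) + real n *\<^sub>R \<theta>0" using h(1) lat by (simp add: lattice_diff_def)
    also have "\<dots> = inv H x + D z + (real n *\<^sub>R \<theta>0 + \<gamma>)" by (simp add: D_def z algebra_simps)
    finally have Gn: "(G ^^ n) x = H (inv H x + D z + (real n *\<^sub>R \<theta>0 + \<gamma>))" .
    have "(G ^^ n) x - (A (D z) + c) = (H (inv H x + D z + (real n *\<^sub>R \<theta>0 + \<gamma>))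
        - A (inv H x + D z + (real n *\<^sub>R \<theta>0 + \<gamma>))) + A (inv H x)"
      unfolding Gn c_def by (simp add: linear_add[OF AB(1)] algebra_simps)
    moreover have "norm (A (inv H x)) \<le> C1 * a"
      by (rule order_trans[OF a(2)]) (use C1[OF x] a(1) in simp)
    ultimately show ?thesis
      unfolding dist_norm by (simp only:) (intro norm_triangle_le add_mono AB(9))
  qed
  have E_ge: "C + C1 * a \<le> E"
  proof -
    have "0 \<le> L" unfolding L_def by (rule sum_list_nonneg) auto
    then show ?thesis unfolding E_def using a(1) by simp
  qed
  have AvB: "map A (map B us) = us" for us by (induction us) (simp_all add: AB(3))
  have "hausdorff_near (E + 1) ((G ^^ n) ` unit_square) ((\<lambda>z. real M *\<^sub>R z + c) ` zonotope 1 vs)"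
  proof (rule hausdorff_nearI[of _ _ E])
    fix y assume "y \<in> (G ^^ n) ` unit_square"
    then obtain x where x: "x \<in> unit_square" "y = (G ^^ n) x" by blast
    define z where "z = inv h (inv H x)"
    have "h z = inv H x" unfolding z_def using bijh by (simp add: bij_is_surj surj_f_inv_f)
    from est[OF x(1) this] have "dist y (A (D z) + c) \<le> E" using E_ge x(2) by simp
    moreover have "A (D z) \<in> zonotope (real M) vs"
      using zonotope_linear_image[OF AB(1) h(2)[of z]] unfolding AvB D_def .
    then obtain u where "u \<in> zonotope 1 vs" "A (D z) = real M *\<^sub>R u"
      using zonotope_eq_scale[of "real M" vs] \<open>M > 0\<close> by auto
    ultimately show "\<exists>u\<in>(\<lambda>z. real M *\<^sub>R z + c) ` zonotope 1 vs. dist y u \<le> E" by auto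
  next
    fix y assume "y \<in> (\<lambda>z. real M *\<^sub>R z + c) ` zonotope 1 vs"
    then obtain u where u: "u \<in> zonotope 1 vs" "y = real M *\<^sub>R u + c" by blast
    then have "real M *\<^sub>R u \<in> zonotope (real M) vs"
      using zonotope_eq_scale[of "real M" vs] \<open>M > 0\<close> by auto
    then obtain y0 where y0: "y0 \<in> int_combinations M vs" "norm (real M *\<^sub>R u - y0) \<le> L"
      using zonotope_near_int_combinations unfolding L_def by blast
    obtain y1 where y1: "y1 \<in> int_combinations M (map B vs)" "y0 = A y1"
      using int_combinations_linear_image[OF AB(1), of y0 M "map B vs"] y0(1) unfolding AvB by blast
    obtain t where t: "norm (D t - y1) < 1" using h(3)[OF y1(1)] unfolding D_def by blast
    \<comment> \<open>\<open>H (h t)\<close> may lie outside the unit square; a deck translation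
      brings it there and leaves \<open>D\<close> unchanged.\<close>
    obtain k where k: "k \<in> intvecs" "H (h t) - k \<in> unit_square" using unit_square_cover by blast
    define x z where "x = H (h t) - k" and "z = t - B k"
    have "h z = h t - B k" "h (z + \<gamma>) = h (t + \<gamma>) - B k"
    proof -
      have "real q *\<^sub>R (- B k) \<in> intvecs" using AB(6)[OF k(1)] intvecs_lattice intvecs_minus by blast
      then have "h (s + - B k) = h s + - B k" for s using h(1) unfolding lattice_diff_def by blast
      from this[of t] this[of "t + \<gamma>"] show "h z = h t - B k" "h (z + \<gamma>) = h (t + \<gamma>) - B k"
        by (simp_all add: z_def algebra_simps)
    qed
    moreover have "inv H x = h t - B k"
    proof -
      have "h t = inv H (x + k)" unfolding x_def using bij by (simp add: bij_is_inj)
      also have "\<dots> = inv H x + B k" by (rule AB(8)[OF k(1)])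
      finally show ?thesis by simp
    qed
    ultimately have z: "h z = inv H x" "D z = D t" by (simp_all add: D_def)
    have x: "x \<in> unit_square" using k(2) by (simp add: x_def)
    have "dist ((G ^^ n) x) (A (D t) + c) \<le> C + C1 * a" using est[OF x z(1)] z(2) by simp
    moreover have "dist (A (D t) + c) (y0 + c) \<le> a"
    proof -
      have "dist (A (D t) + c) (y0 + c) = norm (A (D t - y1))"
        by (simp add: y1(2) dist_norm linear_diff[OF AB(1)])
      also have "\<dots> \<le> norm (D t - y1) * a" by (rule a(2))
      also have "\<dots> \<le> 1 * a" using t a(1) by (intro mult_right_mono) auto
      finally show ?thesis by simp
    qed
    moreover have "dist (y0 + c) y \<le> L" using y0(2) by (simp add: u(2) dist_norm norm_minus_commute)
    ultimately have "dist ((G ^^ n) x) y \<le> E"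
      using dist_triangle[of "(G ^^ n) x" y "A (D t) + c"] dist_triangle[of "A (D t) + c" y "y0 + c"]
      unfolding E_def by linarith
    then have "dist y ((G ^^ n) x) \<le> E" by (simp add: dist_commute)
    then show "\<exists>x\<in>(G ^^ n) ` unit_square. dist y x \<le> E" using x by blast
  qed simp
  then have "tracks G ps j" unfolding tracks_def vs_def
    by (intro exI conjI) (rule Mj, rule ME)
  with close h(1) show ?thesis
    unfolding G_def by (intro exI[of _ h] exI[of _ \<theta>'] exI[of _ q] conjI)
qed

section \<open>Generalized rotation sets of generic maps\<close>

text \<open>Two errors of s/(i + 1) add up: the approximation of \<open>K\<close> by a zonotope,
  scaled by s, and the error allowed by \<open>tracks\<close>.\<close>

lemma tracks_imp_near_scaled:
  assumes "\<And>ps j. tracks F ps j"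
    and K: "compact K" "convex K" "K \<noteq> {}" "point_symmetric K"
  shows "\<exists>n s c. real (Suc i) \<le> s \<and>
    hausdorff_near (2 * s / real (Suc i)) ((F ^^ n) ` unit_square) ((\<lambda>x. s *\<^sub>R x + c) ` K)"
proof -
  obtain ps t c0 where t: "t > 0"
    "hausdorff_near (1 / real (Suc i)) ((\<lambda>z. t *\<^sub>R z + c0) ` zonotope 1 (map odd_vec ps)) K"
    using point_symmetric_convex_near_odd_zonotope[OF K, of "1 / real (Suc i)"] by auto
  \<comment> \<open>Ensures both that s = r/t is at least i + 1 and that r/(j + 1) is at most s/(i +
    1).\<close>
  obtain j :: nat where j: "t * real (Suc i) < real j" using reals_Archimedean2 by blast
  define Z where "Z = zonotope 1 (map odd_vec ps)"
  obtain n r c e where r: "real (Suc j) \<le> r" "e < r / real (Suc j)"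
    "hausdorff_near e ((F ^^ n) ` unit_square) ((\<lambda>z. r *\<^sub>R z + c) ` Z)"
    using assms(1)[of ps j] unfolding tracks_def Z_def by blast
  define s where "s = r / t"
  have "t * real (Suc i) \<le> r" using j r(1) by linarith
  then have s: "real (Suc i) \<le> s" using t(1) by (simp add: s_def field_simps)
  have s0: "s > 0" using s by (simp add: less_le_trans[of 0 "real (Suc i)"])
  have r0: "r > 0" using s0 t(1) by (simp add: s_def zero_less_divide_iff)
  have "r / real (Suc j) \<le> s / real (Suc i)"
  proof -
    have "real (Suc i) * t \<le> real (Suc j)" using j by (simp add: mult.commute)
    then have "r * (real (Suc i) * t) \<le> r * real (Suc j)" using r0 by (intro mult_left_mono) auto
    then show ?thesis using t(1) unfolding s_def by (simp add: divide_simps mult.commute mult.left_commute)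
  qed
  then have near1: "hausdorff_near (s / real (Suc i)) ((F ^^ n) ` unit_square) ((\<lambda>z. r *\<^sub>R z + c) ` Z)"
    using hausdorff_near_mono[OF r(3)] r(2) by simp
  have "hausdorff_near (s * (1 / real (Suc i)))
     ((\<lambda>x. s *\<^sub>R x + (c - s *\<^sub>R c0)) ` (\<lambda>z. t *\<^sub>R z + c0) ` Z) ((\<lambda>x. s *\<^sub>R x + (c - s *\<^sub>R c0)) ` K)"
    using hausdorff_near_affine[OF t(2) s0] unfolding Z_def .
  moreover have "(\<lambda>x. s *\<^sub>R x + (c - s *\<^sub>R c0)) ` (\<lambda>z. t *\<^sub>R z + c0) ` Z = (\<lambda>z. r *\<^sub>R z + c) ` Z"
    unfolding image_image using t(1) by (intro image_cong refl) (simp add: s_def algebra_simps)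
  ultimately have "hausdorff_near (s / real (Suc i)) ((\<lambda>z. r *\<^sub>R z + c) ` Z) ((\<lambda>x. s *\<^sub>R x + (c - s *\<^sub>R c0)) ` K)"
    by simp
  from hausdorff_near_trans[OF near1 this] s show ?thesis
    by (intro exI[of _ n] exI[of _ s] exI[of _ "c - s *\<^sub>R c0"] conjI) simp_all
qed

lemma diameter_near_scaled:
  assumes near: "hausdorff_near e S ((\<lambda>x. s *\<^sub>R x + c) ` K)" and "bounded S" "compact K" "K \<noteq> {}" "s > 0"
  shows "\<bar>diameter S - s * diameter K\<bar> \<le> 2 * e"
proof -
  have dist_aff: "dist (s *\<^sub>R x + c) (s *\<^sub>R y + c) = s * dist x y" for x y
    using assms(5) by (simp add: dist_norm scaleR_diff_right[symmetric])
  have near1: "\<exists>u\<in>K. dist x (s *\<^sub>R u + c) < e" if "x \<in> S" for x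
    using near that by (auto simp: hausdorff_near_def)
  have near2: "\<exists>x\<in>S. dist x (s *\<^sub>R u + c) < e" if "u \<in> K" for u
    using near that by (auto simp: hausdorff_near_def)
  have "S \<noteq> {}" using near assms(4) by (auto simp: hausdorff_near_def)
  then have "diameter S \<le> s * diameter K + 2 * e"
  proof (intro diameter_le disjI1)
    fix x y assume "x \<in> S" "y \<in> S"
    then obtain u v where uv: "u \<in> K" "dist x (s *\<^sub>R u + c) < e" "v \<in> K" "dist y (s *\<^sub>R v + c) < e"
      using near1 by meson
    have "dist u v \<le> diameter K" using diameter_bounded_bound[OF compact_imp_bounded[OF assms(3)] uv(1,3)] .
    then have "s * dist u v \<le> s * diameter K" using assms(5) by simp
    then show "norm (x - y) \<le> s * diameter K + 2 * e"
      using uv dist_aff[of u v] dist_triangle[of x y "s *\<^sub>R u + c"]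
        dist_triangle[of "s *\<^sub>R u + c" y "s *\<^sub>R v + c"]
      by (simp add: dist_norm norm_minus_commute)
  qed
  moreover have "s * diameter K \<le> diameter S + 2 * e"
  proof -
    obtain u v where uv: "u \<in> K" "v \<in> K" "dist u v = diameter K"
      using diameter_compact_attained[OF assms(3,4)] by blast
    obtain x y where xy: "x \<in> S" "dist x (s *\<^sub>R u + c) < e" "y \<in> S" "dist y (s *\<^sub>R v + c) < e"
      using near2 uv by meson
    have "dist x y \<le> diameter S" using diameter_bounded_bound[OF assms(2) xy(1,3)] .
    then show ?thesis
      using xy uv(3) dist_aff[of u v] dist_triangle[of "s *\<^sub>R u + c" "s *\<^sub>R v + c" x]
        dist_triangle[of x "s *\<^sub>R v + c" y]
      by (simp add: dist_commute)
  qed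
  ultimately show ?thesis by linarith
qed

lemma hausdorff_near_image:
  assumes "\<And>x. x \<in> K \<Longrightarrow> dist (f x) (g x) < e"
  shows "hausdorff_near e (f ` K) (g ` K)"
  using assms unfolding hausdorff_near_def by blast

lemma hausdorff_conv_iff:
  "hausdorff_conv S K \<longleftrightarrow> compact K \<and> K \<noteq> {} \<and> (\<forall>e>0. eventually (\<lambda>i. hausdorff_near e (S i) K) sequentially)"
proof -
  have "S i \<subseteq> (\<Union>y\<in>K. ball y e) \<and> K \<subseteq> (\<Union>y\<in>S i. ball y e) \<longleftrightarrow> hausdorff_near e (S i) K" for e i
    unfolding hausdorff_near_def subset_iff by (simp add: dist_commute Ball_def)
  then show ?thesis by (simp add: hausdorff_conv_def)
qed

text \<open>Rescaling \<open>S\<close> costs e/d and putting \<open>p\<close> at the image of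
  \<open>k\<close> another e/d; the other terms pay for replacing the ratio s/d by \<open>b\<close>
  and the base point \<open>k\<close> by \<open>k'\<close>.\<close>

lemma normalized_near:
  fixes p :: R2
  assumes near: "hausdorff_near e S ((\<lambda>x. s *\<^sub>R x + c) ` K)" and "d > 0" "bounded K" "k \<in> K"
    and p: "dist p (s *\<^sub>R k + c) < e" and b: "b > 0"
  shows "hausdorff_near (2 * (e / d) + \<bar>s / d - b\<bar> * diameter K + b * dist k k')
    ((\<lambda>y. (1 / d) *\<^sub>R (y - p)) ` S) ((\<lambda>x. b *\<^sub>R (x - k')) ` K)"
proof -
  have "hausdorff_near (1 / d * e) ((\<lambda>y. (1 / d) *\<^sub>R y + (- (1 / d) *\<^sub>R p)) ` S)
      ((\<lambda>y. (1 / d) *\<^sub>R y + (- (1 / d) *\<^sub>R p)) ` (\<lambda>x. s *\<^sub>R x + c) ` K)"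
    by (rule hausdorff_near_affine[OF near]) (use \<open>d > 0\<close> in simp)
  then have "hausdorff_near (e / d) ((\<lambda>y. (1 / d) *\<^sub>R (y - p)) ` S)
      ((\<lambda>x. (1 / d) *\<^sub>R (s *\<^sub>R x + c - p)) ` K)"
    by (simp add: image_image scaleR_diff_right)
  moreover have "hausdorff_near (e / d + \<bar>s / d - b\<bar> * diameter K + b * dist k k')
      ((\<lambda>x. (1 / d) *\<^sub>R (s *\<^sub>R x + c - p)) ` K) ((\<lambda>x. b *\<^sub>R (x - k')) ` K)"
  proof (rule hausdorff_near_image)
    fix x assume "x \<in> K"
    have "(1 / d) *\<^sub>R (s *\<^sub>R x + c - p) - b *\<^sub>R (x - k')
        = ((1 / d) *\<^sub>R (s *\<^sub>R k + c - p) + (s / d - b) *\<^sub>R (x - k)) + - b *\<^sub>R (k - k')"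
      by (simp add: algebra_simps divide_inverse)
    moreover have "norm ((1 / d) *\<^sub>R (s *\<^sub>R k + c - p)) < e / d"
      using p \<open>d > 0\<close> by (simp add: dist_norm norm_minus_commute divide_strict_right_mono)
    moreover have "norm ((s / d - b) *\<^sub>R (x - k)) \<le> \<bar>s / d - b\<bar> * diameter K"
      using diameter_bounded_bound[OF assms(3) \<open>x \<in> K\<close> assms(4)]
      unfolding norm_scaleR dist_norm by (intro mult_left_mono) auto
    moreover have "norm (- b *\<^sub>R (k - k')) = b * dist k k'" using b by (simp add: dist_norm)
    ultimately show "dist ((1 / d) *\<^sub>R (s *\<^sub>R x + c - p)) (b *\<^sub>R (x - k'))
        < e / d + \<bar>s / d - b\<bar> * diameter K + b * dist k k'"
      unfolding dist_norm
      using norm_triangle_ineq[of "(1 / d) *\<^sub>R (s *\<^sub>R k + c - p) + (s / d - b) *\<^sub>R (x - k)" "- b *\<^sub>R (k - k')"]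
        norm_triangle_ineq[of "(1 / d) *\<^sub>R (s *\<^sub>R k + c - p)" "(s / d - b) *\<^sub>R (x - k)"]
      by (simp only:)
  qed
  ultimately show ?thesis
    by (rule hausdorff_near_mono[OF hausdorff_near_trans]) simp
qed

text \<open>The approximations control \<open>F\<^sup>n D\<close> only up to translation; the position of \<open>F\<^sup>n x0\<close> in it is
  made to converge by passing to a subsequence.\<close>

lemma tracks_imp_all_shapes:
  assumes tr: "\<And>ps j. tracks F ps j" and F: "continuous_on UNIV F" and x0: "x0 \<in> unit_square"
  shows "all_shapes_property x0 F"
  unfolding all_shapes_property_def
proof (intro allI impI, elim conjE bexE)
  fix K x y assume K: "compact K" "convex K" "point_symmetric K" and xy: "x \<in> K" "y \<in> K" "x \<noteq> y"
  have Kne: "K \<noteq> {}" using xy(1) by blast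
  define \<kappa> where "\<kappa> = diameter K"
  have "dist x y \<le> \<kappa>"
    unfolding \<kappa>_def by (rule diameter_bounded_bound[OF compact_imp_bounded[OF K(1)] xy(1,2)])
  moreover have "dist x y > 0" using xy(3) by simp
  ultimately have \<kappa>: "\<kappa> > 0" by linarith
  have "\<forall>i. \<exists>n s c. real (Suc i) \<le> s \<and>
    hausdorff_near (2 * s / real (Suc i)) ((F ^^ n) ` unit_square) ((\<lambda>x. s *\<^sub>R x + c) ` K)"
    using tracks_imp_near_scaled[OF tr K(1,2) Kne K(3)] by blast
  then obtain n s c where nsc: "\<And>i. real (Suc i) \<le> s i"
    "\<And>i. hausdorff_near (2 * s i / real (Suc i)) ((F ^^ n i) ` unit_square) ((\<lambda>x. s i *\<^sub>R x + c i) ` K)"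
    by metis
  have s0: "s i > 0" for i using nsc(1)[of i] by (simp add: less_le_trans[of 0 "real (Suc i)"])
  define d where "d i = diameter ((F ^^ n i) ` unit_square)" for i
  define p where "p i = (F ^^ n i) x0" for i
  have cont: "continuous_on UNIV (F ^^ m)" for m
  proof (induction m)
    case (Suc m)
    then show ?case using continuous_on_compose[OF Suc continuous_on_subset[OF F]] by simp
  qed (simp add: continuous_on_id)
  have bdd: "bounded ((F ^^ m) ` unit_square)" for m
    by (intro compact_imp_bounded compact_continuous_image compact_unit_square continuous_on_subset[OF cont]) simp
  have diam: "\<bar>d i - s i * \<kappa>\<bar> \<le> 2 * (2 * s i / real (Suc i))" for i
    unfolding d_def \<kappa>_def by (rule diameter_near_scaled[OF nsc(2) bdd K(1) Kne s0])
  have ds: "\<bar>d i / s i - \<kappa>\<bar> \<le> 4 / real (Suc i)" for i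
  proof -
    have "\<bar>d i / s i - \<kappa>\<bar> = \<bar>d i - s i * \<kappa>\<bar> / s i"
    proof -
      have "d i / s i - \<kappa> = (d i - s i * \<kappa>) / s i" using s0[of i] by (simp add: field_simps)
      then show ?thesis using s0[of i] by (simp only: abs_divide abs_of_pos)
    qed
    also have "\<dots> \<le> 2 * (2 * s i / real (Suc i)) / s i"
      by (rule divide_right_mono[OF diam]) (use s0[of i] in simp)
    also have "\<dots> = 4 / real (Suc i)" using s0[of i] by simp
    finally show ?thesis .
  qed
  have lim4: "(\<lambda>i. 4 / real (Suc i)) \<longlonglongrightarrow> 0"
    using tendsto_mult_right_zero[OF LIMSEQ_inverse_real_of_nat, of 4] by (simp add: divide_inverse)
  have "(\<lambda>i. d i / s i - \<kappa>) \<longlonglongrightarrow> 0"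
    by (rule Lim_null_comparison[OF _ lim4]) (use ds in auto)
  then have lim_ds: "(\<lambda>i. d i / s i) \<longlonglongrightarrow> \<kappa>" by (simp add: LIM_zero_iff)
  have s_top: "filterlim s at_top sequentially"
  proof (rule filterlim_at_top_mono[of real])
    show "filterlim real at_top sequentially" by (rule filterlim_real_sequentially)
    show "eventually (\<lambda>i. real i \<le> s i) sequentially"
    proof (rule always_eventually, rule allI)
      fix i show "real i \<le> s i" using nsc(1)[of i] by simp
    qed
  qed
  have "filterlim (\<lambda>i. d i / s i * s i) at_top sequentially"
    by (rule filterlim_tendsto_pos_mult_at_top[OF lim_ds \<kappa> s_top])
  moreover have "d i / s i * s i = d i" for i using s0[of i] by simp
  ultimately have d_top: "filterlim d at_top sequentially" by simp
  \<comment> \<open>These points of \<open>K\<close> record where the iterate of \<open>x0\<close>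
    sits after rescaling.\<close>
  have "\<exists>k\<in>K. dist (p i) (s i *\<^sub>R k + c i) < 2 * s i / real (Suc i)" for i
    using nsc(2)[of i] x0 unfolding hausdorff_near_def p_def by blast
  then obtain k where k: "\<And>i. k i \<in> K" "\<And>i. dist (p i) (s i *\<^sub>R k i + c i) < 2 * s i / real (Suc i)"
    by metis
  obtain k0 \<sigma> where k0: "k0 \<in> K" "strict_mono \<sigma>" "(k \<circ> \<sigma>) \<longlonglongrightarrow> k0"
    using K(1) k(1) unfolding compact_def by metis
  \<comment> \<open>The expected limit: \<open>K\<close> scaled to diameter 1, with the limiting
    position of \<open>x0\<close> moved to the origin.\<close>
  define R where "R = (\<lambda>x. (1 / \<kappa>) *\<^sub>R (x - k0)) ` K"
  define E where "E i = 4 / real (Suc i) * (s i / d i) + \<bar>s i / d i - 1 / \<kappa>\<bar> * \<kappa>" for i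
  have lim_sd: "(\<lambda>i. s i / d i) \<longlonglongrightarrow> 1 / \<kappa>"
    using tendsto_inverse[OF lim_ds] \<kappa> by (simp add: inverse_eq_divide)
  have "E \<longlonglongrightarrow> 0 * (1 / \<kappa>) + \<bar>1 / \<kappa> - 1 / \<kappa>\<bar> * \<kappa>"
    unfolding E_def[abs_def] by (intro tendsto_intros lim4 lim_sd)
  then have "E \<longlonglongrightarrow> 0" by simp
  then have E\<sigma>: "(\<lambda>i. E (\<sigma> i)) \<longlonglongrightarrow> 0"
    using LIMSEQ_subseq_LIMSEQ[OF _ k0(2)] by (auto simp: o_def)
  have "(\<lambda>i. dist (k (\<sigma> i)) k0) \<longlonglongrightarrow> 0" using k0(3) unfolding o_def by (rule tendsto_dist_iff[THEN iffD1])
  from tendsto_add[OF E\<sigma> tendsto_mult_right_zero[OF this, of "1 / \<kappa>"]]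
  have err: "(\<lambda>i. E (\<sigma> i) + 1 / \<kappa> * dist (k (\<sigma> i)) k0) \<longlonglongrightarrow> 0" by simp
  have d\<sigma>: "filterlim (\<lambda>i. d (\<sigma> i)) at_top sequentially"
    using filterlim_compose[OF d_top filterlim_subseq[OF k0(2)]] .
  have near: "hausdorff_near (E (\<sigma> i) + 1 / \<kappa> * dist (k (\<sigma> i)) k0)
      ((\<lambda>y. (1 / d (\<sigma> i)) *\<^sub>R (y - p (\<sigma> i))) ` ((F ^^ n (\<sigma> i)) ` unit_square)) R"
    if "d (\<sigma> i) > 0" for i
  proof -
    have eq: "2 * (2 * s (\<sigma> i) / real (Suc (\<sigma> i)) / d (\<sigma> i)) + \<bar>s (\<sigma> i) / d (\<sigma> i) - 1 / \<kappa>\<bar> * diameter K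
      + 1 / \<kappa> * dist (k (\<sigma> i)) k0 = E (\<sigma> i) + 1 / \<kappa> * dist (k (\<sigma> i)) k0"
      by (simp add: E_def \<kappa>_def)
    have "1 / \<kappa> > 0" using \<kappa> by simp
    from normalized_near[OF nsc(2)[of "\<sigma> i"] that compact_imp_bounded[OF K(1)] k(1) k(2) this, where k' = k0]
    show ?thesis unfolding eq R_def .
  qed
  have "hausdorff_conv (\<lambda>i. (\<lambda>y. (1 / d (\<sigma> i)) *\<^sub>R (y - p (\<sigma> i))) ` ((F ^^ n (\<sigma> i)) ` unit_square)) R"
    unfolding hausdorff_conv_iff
  proof (intro conjI allI impI)
    show "compact R" unfolding R_def by (intro compact_continuous_image continuous_intros K(1))
    show "R \<noteq> {}" unfolding R_def using Kne by simp
    fix e :: real assume "e > 0"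
    have "eventually (\<lambda>i. d (\<sigma> i) > 0) sequentially"
      using d\<sigma> by (simp add: filterlim_at_top_dense)
    moreover have "eventually (\<lambda>i. E (\<sigma> i) + 1 / \<kappa> * dist (k (\<sigma> i)) k0 < e) sequentially"
      using order_tendstoD(2)[OF err \<open>e > 0\<close>] .
    ultimately show "eventually (\<lambda>i. hausdorff_near e
       ((\<lambda>y. (1 / d (\<sigma> i)) *\<^sub>R (y - p (\<sigma> i))) ` ((F ^^ n (\<sigma> i)) ` unit_square)) R) sequentially"
      by eventually_elim (rule hausdorff_near_mono[OF near], auto)
  qed
  then have "gen_rot_set F x0 R"
    unfolding gen_rot_set_def d_def p_def using d\<sigma>[unfolded d_def] by (intro exI[of _ "\<lambda>i. n (\<sigma> i)"] conjI)
  moreover have "same_homothety_type R K"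
    unfolding same_homothety_type_def
  proof (intro exI[of _ \<kappa>] exI[of _ k0] conjI)
    show "\<kappa> > 0" by (rule \<kappa>)
    show "K = (\<lambda>x. \<kappa> *\<^sub>R x + k0) ` R" unfolding R_def image_image using \<kappa> by simp
  qed
  ultimately show "\<exists>R. gen_rot_set F x0 R \<and> same_homothety_type R K" by blast
qed

lemma conj_rot_in_closure:
  assumes "torus_diff_lift H" "conj_rot \<theta> H \<in> S"
  shows "conj_rot \<theta> H \<in> Cinf_closure S"
  unfolding Cinf_closure_def using assms lift_diff_conj_rot by (auto simp: cdist_self intro!: bexI)

text \<open>The hypothesis isolates the closure property shared by \<open>Orb\<close> and
  \<open>Orb_mu\<close>: the conjugacy may be composed with any \<open>lattice_diff\<close>, which
  preserves area.\<close>

lemma Cinf_dense_in_tracks: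
  assumes S: "\<And>F. F \<in> S \<Longrightarrow> \<exists>\<theta> H. torus_diff_lift H \<and> F = conj_rot \<theta> H \<and>
      (\<forall>q h \<theta>'. lattice_diff q h \<longrightarrow> conj_rot \<theta>' (H \<circ> h) \<in> S)"
  shows "Cinf_dense_in (Cinf_closure S) {F \<in> Cinf_closure S. tracks F ps j}"
  unfolding Cinf_dense_in_def
proof (intro ballI allI impI)
  fix F k and \<epsilon> :: real assume F: "F \<in> Cinf_closure S" and "\<epsilon> > 0"
  then have e2: "\<epsilon> / 2 > 0" by simp
  then obtain G where G: "G \<in> S" "cdist k F G < ereal (\<epsilon> / 2)" using F unfolding Cinf_closure_def by blast
  obtain \<theta> H where H: "torus_diff_lift H" "G = conj_rot \<theta> H"
    "\<And>q h \<theta>'. lattice_diff q h \<Longrightarrow> conj_rot \<theta>' (H \<circ> h) \<in> S" using S[OF G(1)] by blast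
  obtain h \<theta>' q where h: "lattice_diff q h" "tracks (conj_rot \<theta>' (H \<circ> h)) ps j"
    "cdist k G (conj_rot \<theta>' (H \<circ> h)) < ereal (\<epsilon> / 2)"
    using tracking_conj_rot_near[OF H(1) e2, of ps j k \<theta>] unfolding H(2) by blast
  have Hh: "torus_diff_lift (H \<circ> h)" by (rule torus_diff_lift_comp[OF H(1) h(1)])
  let ?G = "conj_rot \<theta>' (H \<circ> h)"
  have "cdist k F ?G \<le> cdist k F G + cdist k G ?G"
    using F lift_diff_conj_rot[OF H(1), of \<theta>] lift_diff_conj_rot[OF Hh, of \<theta>']
    by (intro cdist_triangle) (auto simp: H(2) Cinf_closure_def lift_diff_def)
  also have "\<dots> < ereal (\<epsilon> / 2) + ereal (\<epsilon> / 2)" by (rule ereal_add_strict_mono2[OF G(2) h(3)])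
  finally have "cdist k F ?G < ereal \<epsilon>" by simp
  moreover have "?G \<in> Cinf_closure S" by (rule conj_rot_in_closure[OF Hh H(3)[OF h(1)]])
  ultimately show "\<exists>G\<in>{F \<in> Cinf_closure S. tracks F ps j}. cdist k F G < ereal \<epsilon>" using h(2) by blast
qed

lemma generic_in_closure_all_shapes:
  assumes S: "\<And>F. F \<in> S \<Longrightarrow> \<exists>\<theta> H. torus_diff_lift H \<and> F = conj_rot \<theta> H \<and>
      (\<forall>q h \<theta>'. lattice_diff q h \<longrightarrow> conj_rot \<theta>' (H \<circ> h) \<in> S)"
    and x0: "x0 \<in> unit_square"
  shows "generic_in (Cinf_closure S) (all_shapes_property x0)"
  unfolding generic_in_def
proof (intro exI conjI allI ballI)
  \<comment> \<open>Pairs of an integer list and a natural number are countable, so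
    \<open>from_nat\<close> enumerates all conditions \<open>tracks\<close>.\<close>
  let ?p = "\<lambda>m. from_nat m :: (int \<times> int) list \<times> nat"
  let ?U = "\<lambda>m. {F \<in> Cinf_closure S. tracks F (fst (?p m)) (snd (?p m))}"
  show "Cinf_open_in (Cinf_closure S) (?U m)" for m
    by (rule Cinf_open_in_tracks) (simp add: Cinf_closure_def)
  show "Cinf_dense_in (Cinf_closure S) (?U m)" for m by (rule Cinf_dense_in_tracks[OF S])
  fix F assume F: "F \<in> (\<Inter>m. ?U m)"
  have "tracks F ps j" for ps j
  proof -
    have "F \<in> ?U (to_nat (ps, j))" using F by blast
    then show ?thesis by simp
  qed
  moreover have "lift_diff F" using F by (simp add: Cinf_closure_def)
  then have "continuous_on UNIV F" by (simp add: lift_diff_def smooth_continuous_on)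
  ultimately show "all_shapes_property x0 F" using tracks_imp_all_shapes x0 by blast
qed

theorem theoremB:
  assumes "x0 \<in> unit_square"
  shows "generic_in AK (all_shapes_property x0) \<and> generic_in AK_mu (all_shapes_property x0)"
proof
  show "generic_in AK (all_shapes_property x0)"
    unfolding AK_def
  proof (rule generic_in_closure_all_shapes[OF _ assms])
    fix F assume "F \<in> Orb"
    then show "\<exists>\<theta> H. torus_diff_lift H \<and> F = conj_rot \<theta> H \<and>
      (\<forall>q h \<theta>'. lattice_diff q h \<longrightarrow> conj_rot \<theta>' (H \<circ> h) \<in> Orb)"
      unfolding Orb_def using torus_diff_lift_comp by blast
  qed
  show "generic_in AK_mu (all_shapes_property x0)"
    unfolding AK_mu_def
  proof (rule generic_in_closure_all_shapes[OF _ assms])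
    fix F assume "F \<in> Orb_mu"
    then obtain \<theta> H where H: "torus_diff_lift H" "area_pres H" "F = conj_rot \<theta> H"
      unfolding Orb_mu_def by blast
    have "conj_rot \<theta>' (H \<circ> h) \<in> Orb_mu" if h: "lattice_diff q h" for q h \<theta>'
    proof -
      have "torus_diff_lift (H \<circ> h)" by (rule torus_diff_lift_comp[OF H(1) h])
      moreover have "area_pres (H \<circ> h)" using h by (intro area_pres_comp H(2)) (simp add: lattice_diff_def)
      ultimately show ?thesis unfolding Orb_mu_def by blast
    qed
    with H show "\<exists>\<theta> H. torus_diff_lift H \<and> F = conj_rot \<theta> H \<and>
      (\<forall>q h \<theta>'. lattice_diff q h \<longrightarrow> conj_rot \<theta>' (H \<circ> h) \<in> Orb_mu)" by blast
  qed
qed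

end
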